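(* Let $G_1, G_2$ be two finite groups and, for $j=1,2$, let $Z_j$ be a central subgroup of $G_j$ such that the sequence $$1 \to \mathrm{Hom}(Z_j,\mathbb C^\times) \xrightarrow{\mathrm{tra}_j} H^2(G_j/Z_j,\mathbb C^\times) \xrightarrow{\inf_j} H^2(G_j,\mathbb C^\times) \to 1$$ is exact, where $\mathrm{tra}_j$ is the transgression map associated with $1\to Z_j\to G_j\to G_j/Z_j\to 1$ and $\inf_j$ is inflation. Suppose there are group isomorphisms $i:Z_2\to Z_1$ and $\phi:G_2/Z_2\to G_1/Z_1$ such that the induced isomorphisms $\bar i:\mathrm{Hom}(Z_1,\mathbb C^\times)\to\mathrm{Hom}(Z_2,\mathbb C^\times)$ and $\bar\phi:H^2(G_1/Z_1,\mathbb C^\times)\to H^2(G_2/Z_2,\mathbb C^\times)$ satisfy $$\bar\phi\circ\mathrm{tra}_1=\mathrm{tra}_2\circ\bar i .$$ Then $G_1\sim_{\mathbb C}G_2$.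
   Context: For a finite group $G$, $Z^2(G,\mathbb C^\times)$ is the group of $2$-cocycles with trivial $G$-action on $\mathbb C^\times$, and $H^2(G,\mathbb C^\times)$ is the second cohomology group. For $\alpha\in Z^2(G,\mathbb C^\times)$, the twisted group algebra $\mathbb C^\alpha G$ is the $\mathbb C$-vector space with basis $\{\bar g: g\in G\}$ and multiplication determined by $\bar g\,\bar h=\alpha(g,h)\overline{gh}$; up to isomorphism it depends only on the class $[\alpha]$. For finite groups $G,H$ we write $G\sim_{\mathbb C}H$ if there is a group isomorphism $\psi:H^2(G,\mathbb C^\times)\to H^2(H,\mathbb C^\times)$ such that $\mathbb C^\alpha G\cong\mathbb C^{\psi(\alpha)}H$ (as $\mathbb C$-algebras) for every $[\alpha]\in H^2(G,\mathbb C^\times)$, where $\psi(\alpha)$ denotes a cocycle representing $\psi([\alpha])$. Inflation: for $Z\trianglelefteq G$, $\inf:H^2(G/Z,\mathbb C^\times)\to H^2(G,\mathbb C^\times)$ sends $[\alpha]$ to $[\alpha']$ with $\alpha'(x,y)=\alpha(xZ,yZ)$. Transgression: for a central extension $1\to Z\to G\to G/Z\to 1$ with a section $\mu: G/Z\to G$, $\mathrm{tra}:\mathrm{Hom}(Z,\mathbb C^\times)\to H^2(G/Z,\mathbb C^\times)$ sends $\chi$ to the class of $(x,y)\mapsto\chi(\mu(x)\mu(y)\mu(xy)^{-1})$. Induced isomorphisms: $\bar i(\chi)=\chi\circ i$, and $\bar\phi([\alpha])=[\beta]$ with $\beta(g,h)=\alpha(\phi(g),\phi(h))$ for $g,h\in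 G_2/Z_2$. *)

theory Defs
  imports Complex_Main "HOL-Algebra.Algebra"
begin

section \<open>Cocycles and second cohomology with trivial action\<close>

definition complex_units :: "complex monoid" where
  "complex_units = \<lparr>carrier = - {0}, monoid.mult = (*), one = 1\<rparr>"

text \<open>
  Cochains are functions on pairs that are \<^const>\<open>undefined\<close> outside the carrier, so that equality
  of cochains is equality of functions. Cocycles are not assumed to be normalized.
\<close>

definition cocycles2 :: "('a, 'm) monoid_scheme \<Rightarrow> ('a \<times> 'a \<Rightarrow> complex) monoid" where
  "cocycles2 G =
    \<lparr>carrier = {\<alpha> \<in> carrier G \<times> carrier G \<rightarrow>\<^sub>E carrier complex_units.
        \<forall>x \<in> carrier G. \<forall>y \<in> carrier G. \<forall>z \<in> carrier G.
          \<alpha> (x, y) * \<alpha> (x \<otimes>\<^bsub>G\<^esub> y, z) = \<alpha> (x, y \<otimes>\<^bsub>G\<^esub> z) * \<alpha> (y, z)},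
     monoid.mult = (\<lambda>\<alpha> \<beta>. \<lambda>p \<in> carrier G \<times> carrier G. \<alpha> p * \<beta> p),
     one = (\<lambda>p \<in> carrier G \<times> carrier G. 1)\<rparr>"

definition coboundary2 :: "('a, 'm) monoid_scheme \<Rightarrow> ('a \<Rightarrow> complex) \<Rightarrow> 'a \<times> 'a \<Rightarrow> complex" where
  "coboundary2 G f = (\<lambda>(x, y) \<in> carrier G \<times> carrier G. f x * f y / f (x \<otimes>\<^bsub>G\<^esub> y))"

definition coboundaries2 :: "('a, 'm) monoid_scheme \<Rightarrow> ('a \<times> 'a \<Rightarrow> complex) set" where
  "coboundaries2 G = coboundary2 G ` (carrier G \<rightarrow> carrier complex_units)"

definition H2 :: "('a, 'm) monoid_scheme \<Rightarrow> ('a \<times> 'a \<Rightarrow> complex) set monoid" where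
  "H2 G = cocycles2 G Mod coboundaries2 G"

definition cohom_class ::
  "('a, 'm) monoid_scheme \<Rightarrow> ('a \<times> 'a \<Rightarrow> complex) \<Rightarrow> ('a \<times> 'a \<Rightarrow> complex) set" where
  "cohom_class G \<alpha> = coboundaries2 G #>\<^bsub>cocycles2 G\<^esub> \<alpha>"

definition pullback2 ::
  "('a, 'm) monoid_scheme \<Rightarrow> ('a \<Rightarrow> 'b) \<Rightarrow> ('b \<times> 'b \<Rightarrow> complex) \<Rightarrow> 'a \<times> 'a \<Rightarrow> complex" where
  "pullback2 G f \<alpha> = (\<lambda>(x, y) \<in> carrier G \<times> carrier G. \<alpha> (f x, f y))"

text \<open>
  For a homomorphism \<open>f\<close> from \<open>G\<close> to \<open>H\<close>, the class of \<open>pullback2 G f \<alpha>\<close> is the same for all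
  members \<open>\<alpha>\<close> of a class in \<open>H2 H\<close>, so the image below is a singleton; see \<open>H2_map_class\<close>.
\<close>

definition H2_map ::
  "('b, 'n) monoid_scheme \<Rightarrow> ('a, 'm) monoid_scheme \<Rightarrow> ('a \<Rightarrow> 'b)
    \<Rightarrow> ('b \<times> 'b \<Rightarrow> complex) set \<Rightarrow> ('a \<times> 'a \<Rightarrow> complex) set" where
  "H2_map H G f = (\<lambda>c \<in> carrier (H2 H). the_elem ((\<lambda>\<alpha>. cohom_class G (pullback2 G f \<alpha>)) ` c))"

definition inflation ::
  "('a, 'm) monoid_scheme \<Rightarrow> 'a set
    \<Rightarrow> ('a set \<times> 'a set \<Rightarrow> complex) set \<Rightarrow> ('a \<times> 'a \<Rightarrow> complex) set" where
  "inflation G Z = H2_map (G Mod Z) G (\<lambda>x. Z #>\<^bsub>G\<^esub> x)"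


section \<open>Transgression\<close>

definition central_subgroup :: "'a set \<Rightarrow> ('a, 'm) monoid_scheme \<Rightarrow> bool" where
  "central_subgroup Z G \<longleftrightarrow>
    subgroup Z G \<and> (\<forall>z \<in> Z. \<forall>g \<in> carrier G. z \<otimes>\<^bsub>G\<^esub> g = g \<otimes>\<^bsub>G\<^esub> z)"

definition is_section :: "('a, 'm) monoid_scheme \<Rightarrow> 'a set \<Rightarrow> ('a set \<Rightarrow> 'a) \<Rightarrow> bool" where
  "is_section G Z \<mu> \<longleftrightarrow>
    (\<forall>x \<in> carrier (G Mod Z). \<mu> x \<in> carrier G \<and> Z #>\<^bsub>G\<^esub> \<mu> x = x)"

definition Hom_units :: "('a, 'm) monoid_scheme \<Rightarrow> ('a \<Rightarrow> complex) monoid" where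
  "Hom_units Z =
    \<lparr>carrier = hom Z complex_units \<inter> extensional (carrier Z),
     monoid.mult = (\<lambda>\<chi> \<psi>. \<lambda>z \<in> carrier Z. \<chi> z * \<psi> z),
     one = (\<lambda>z \<in> carrier Z. 1)\<rparr>"

definition transgression ::
  "('a, 'm) monoid_scheme \<Rightarrow> 'a set \<Rightarrow> ('a set \<Rightarrow> 'a)
    \<Rightarrow> ('a \<Rightarrow> complex) \<Rightarrow> ('a set \<times> 'a set \<Rightarrow> complex) set" where
  "transgression G Z \<mu> \<chi> = cohom_class (G Mod Z)
    (\<lambda>(x, y) \<in> carrier (G Mod Z) \<times> carrier (G Mod Z).
       \<chi> (\<mu> x \<otimes>\<^bsub>G\<^esub> \<mu> y \<otimes>\<^bsub>G\<^esub> inv\<^bsub>G\<^esub> (\<mu> (x \<otimes>\<^bsub>G Mod Z\<^esub> y))))"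

text \<open>
  Exactness of \<open>1 \<rightarrow> A \<rightarrow> B \<rightarrow> C \<rightarrow> 1\<close>. The library's \<^const>\<open>exact_seq\<close> requires all groups to have
  elements of the same type.
\<close>

definition short_exact ::
  "('a, 'k) monoid_scheme \<Rightarrow> ('a \<Rightarrow> 'b) \<Rightarrow> ('b, 'l) monoid_scheme \<Rightarrow> ('b \<Rightarrow> 'c)
    \<Rightarrow> ('c, 'm) monoid_scheme \<Rightarrow> bool" where
  "short_exact A f B g C \<longleftrightarrow> f \<in> mon A B \<and> f ` carrier A = kernel B C g \<and> g \<in> epi B C"


section \<open>Twisted group algebras\<close>

text \<open>
  The element \<open>\<Sum>g. f g \<cdot> basis g\<close> is represented by its coefficient function \<open>f\<close>, and
  multiplication extends \<open>basis g \<cdot> basis h = \<alpha> (g, h) \<cdot> basis (g h)\<close> bilinearly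
  (see \<open>twisted_basis_mult\<close>). Since \<open>\<alpha>\<close> need not be normalized, the unit is
  \<open>inverse (\<alpha> (1, 1)) \<cdot> basis 1\<close>. The carrier \<open>G\<close> is meant to be finite.
\<close>

definition twisted_basis :: "('a, 'm) monoid_scheme \<Rightarrow> 'a \<Rightarrow> 'a \<Rightarrow> complex" where
  "twisted_basis G g = (\<lambda>x \<in> carrier G. if x = g then 1 else 0)"

definition twisted_group_algebra ::
  "('a, 'm) monoid_scheme \<Rightarrow> ('a \<times> 'a \<Rightarrow> complex) \<Rightarrow> (complex, 'a \<Rightarrow> complex) module" where
  "twisted_group_algebra G \<alpha> =
    \<lparr>carrier = carrier G \<rightarrow>\<^sub>E UNIV,
     monoid.mult = (\<lambda>f h. \<lambda>k \<in> carrier G.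
       \<Sum>x \<in> carrier G. \<Sum>y \<in> carrier G. if x \<otimes>\<^bsub>G\<^esub> y = k then f x * h y * \<alpha> (x, y) else 0),
     one = (\<lambda>x \<in> carrier G. inverse (\<alpha> (\<one>\<^bsub>G\<^esub>, \<one>\<^bsub>G\<^esub>)) * twisted_basis G \<one>\<^bsub>G\<^esub> x),
     ring.zero = (\<lambda>x \<in> carrier G. 0),
     ring.add = (\<lambda>f h. \<lambda>x \<in> carrier G. f x + h x),
     module.smult = (\<lambda>c f. \<lambda>x \<in> carrier G. c * f x)\<rparr>"

definition complex_algebra_isomorphic ::
  "(complex, 'a, 'm) module_scheme \<Rightarrow> (complex, 'b, 'n) module_scheme \<Rightarrow> bool" where
  "complex_algebra_isomorphic A B \<longleftrightarrow>
    (\<exists>F \<in> ring_iso A B. \<forall>c. \<forall>x \<in> carrier A. F (c \<odot>\<^bsub>A\<^esub> x) = c \<odot>\<^bsub>B\<^esub> F x)"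

definition tga_equiv :: "('a, 'm) monoid_scheme \<Rightarrow> ('b, 'n) monoid_scheme \<Rightarrow> bool"
    (infix \<open>\<sim>\<^sub>C\<close> 50) where
  "G \<sim>\<^sub>C H \<longleftrightarrow>
    (\<exists>\<psi> \<in> iso (H2 G) (H2 H).
      \<forall>\<alpha> \<in> carrier (cocycles2 G). \<forall>\<beta> \<in> \<psi> (cohom_class G \<alpha>).
        complex_algebra_isomorphic (twisted_group_algebra G \<alpha>) (twisted_group_algebra H \<beta>))"


section \<open>Well-definedness\<close>

lemma cocycles2_comm_group:
  assumes "group G"
  shows "comm_group (cocycles2 G)"
proof -
  interpret group G by fact
  show ?thesis
  proof (rule comm_groupI, goal_cases)
    case (1 \<alpha> \<beta>)
    have "\<alpha> (x, y) * \<beta> (x, y) * (\<alpha> (x \<otimes>\<^bsub>G\<^esub> y, z) * \<beta> (x \<otimes>\<^bsub>G\<^esub> y, z)) =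
        \<alpha> (x, y \<otimes>\<^bsub>G\<^esub> z) * \<beta> (x, y \<otimes>\<^bsub>G\<^esub> z) * (\<alpha> (y, z) * \<beta> (y, z))"
      if "x \<in> carrier G" "y \<in> carrier G" "z \<in> carrier G" for x y z
    proof -
      have "\<alpha> (x, y) * \<alpha> (x \<otimes>\<^bsub>G\<^esub> y, z) = \<alpha> (x, y \<otimes>\<^bsub>G\<^esub> z) * \<alpha> (y, z)"
        and "\<beta> (x, y) * \<beta> (x \<otimes>\<^bsub>G\<^esub> y, z) = \<beta> (x, y \<otimes>\<^bsub>G\<^esub> z) * \<beta> (y, z)"
        using 1 that by (simp_all add: cocycles2_def)
      from arg_cong2[OF this, of "(*)"] show ?thesis by (simp only: ac_simps)
    qed
    with 1 show ?case by (simp add: cocycles2_def complex_units_def PiE_iff)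
  next
    case 2
    then show ?case by (auto simp: cocycles2_def complex_units_def)
  next
    case (3 \<alpha> \<beta> \<gamma>)
    then show ?case by (auto simp: cocycles2_def restrict_def)
  next
    case (4 \<alpha> \<beta>)
    then show ?case by (auto simp: cocycles2_def mult.commute)
  next
    case (5 \<alpha>)
    then show ?case
      by (auto simp: cocycles2_def PiE_iff extensional_def restrict_def)
  next
    case (6 \<alpha>)
    let ?\<beta> = "\<lambda>p \<in> carrier G \<times> carrier G. inverse (\<alpha> p)"
    have "?\<beta> \<in> carrier (cocycles2 G)"
      using 6 by (auto simp: cocycles2_def complex_units_def PiE_iff simp flip: inverse_mult_distrib)
    moreover have "?\<beta> \<otimes>\<^bsub>cocycles2 G\<^esub> \<alpha> = \<one>\<^bsub>cocycles2 G\<^esub>"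
      using 6 by (auto simp: cocycles2_def complex_units_def PiE_iff restrict_def fun_eq_iff)
    ultimately show ?case by blast
  qed
qed

lemma coboundaries2_subgroup:
  assumes "group G"
  shows "subgroup (coboundaries2 G) (cocycles2 G)"
proof -
  interpret group G by fact
  interpret Z: comm_group "cocycles2 G" by (rule cocycles2_comm_group) fact
  have sub: "coboundaries2 G \<subseteq> carrier (cocycles2 G)"
  proof
    fix a assume "a \<in> coboundaries2 G"
    then obtain f where f: "f \<in> carrier G \<rightarrow> carrier complex_units" "a = coboundary2 G f"
      by (auto simp: coboundaries2_def)
    then have nz: "f x \<noteq> 0" if "x \<in> carrier G" for x
      using that by (auto simp: complex_units_def)
    have "a (x, y) * a (x \<otimes>\<^bsub>G\<^esub> y, z) = a (x, y \<otimes>\<^bsub>G\<^esub> z) * a (y, z)"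
      if "x \<in> carrier G" "y \<in> carrier G" "z \<in> carrier G" for x y z
      using that nz[of "x \<otimes>\<^bsub>G\<^esub> y"] nz[of "y \<otimes>\<^bsub>G\<^esub> z"]
      by (simp add: f coboundary2_def m_assoc)
    moreover have "a \<in> carrier G \<times> carrier G \<rightarrow>\<^sub>E carrier complex_units"
      using nz by (auto simp: f coboundary2_def complex_units_def)
    ultimately show "a \<in> carrier (cocycles2 G)"
      by (simp add: cocycles2_def)
  qed
  have mult: "a \<otimes>\<^bsub>cocycles2 G\<^esub> b \<in> coboundaries2 G"
    if "a \<in> coboundaries2 G" "b \<in> coboundaries2 G" for a b
  proof -
    obtain f h where f: "f \<in> carrier G \<rightarrow> carrier complex_units" "a = coboundary2 G f"
      and h: "h \<in> carrier G \<rightarrow> carrier complex_units" "b = coboundary2 G h"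
      using \<open>a \<in> coboundaries2 G\<close> \<open>b \<in> coboundaries2 G\<close> by (auto simp: coboundaries2_def)
    have "a \<otimes>\<^bsub>cocycles2 G\<^esub> b = coboundary2 G (\<lambda>x. f x * h x)"
      using f h by (auto simp: coboundary2_def cocycles2_def restrict_def fun_eq_iff)
    then show ?thesis
      using f h by (auto simp: coboundaries2_def complex_units_def Pi_iff)
  qed
  have inv: "inv\<^bsub>cocycles2 G\<^esub> a \<in> coboundaries2 G" if a: "a \<in> coboundaries2 G" for a
  proof -
    obtain f where f: "f \<in> carrier G \<rightarrow> carrier complex_units" "a = coboundary2 G f"
      using a by (auto simp: coboundaries2_def)
    let ?b = "coboundary2 G (\<lambda>x. inverse (f x))"
    have b: "?b \<in> coboundaries2 G"
      using f by (auto simp: coboundaries2_def complex_units_def Pi_iff)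
    have "?b \<otimes>\<^bsub>cocycles2 G\<^esub> a = \<one>\<^bsub>cocycles2 G\<^esub>"
      using f by (auto simp: coboundary2_def cocycles2_def restrict_def fun_eq_iff
          complex_units_def Pi_iff field_simps)
    then have "inv\<^bsub>cocycles2 G\<^esub> a = ?b"
      using a b sub by (intro Z.inv_equality) auto
    then show ?thesis using b by simp
  qed
  have "coboundary2 G (\<lambda>_. 1) \<in> coboundaries2 G"
    by (auto simp: coboundaries2_def complex_units_def)
  then have "coboundaries2 G \<noteq> {}" by blast
  then show ?thesis using sub mult inv by (intro Z.subgroupI) auto
qed

lemma H2_comm_group:
  assumes "group G"
  shows "comm_group (H2 G)"
  unfolding H2_def
  by (rule comm_group.abelian_FactGroup[OF cocycles2_comm_group coboundaries2_subgroup])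
    (use assms in auto)

lemma pullback2_coboundary:
  assumes "group G" "f \<in> hom G H" "b \<in> coboundaries2 H"
  shows "pullback2 G f b \<in> coboundaries2 G"
proof -
  interpret group G by fact
  obtain h where h: "h \<in> carrier H \<rightarrow> carrier complex_units" "b = coboundary2 H h"
    using assms by (auto simp: coboundaries2_def)
  have "pullback2 G f b = coboundary2 G (h \<circ> f)"
    using assms(2) by (auto simp: h pullback2_def coboundary2_def hom_def restrict_def fun_eq_iff)
  moreover have "h \<circ> f \<in> carrier G \<rightarrow> carrier complex_units"
    using assms(2) h by (auto simp: hom_def)
  ultimately show ?thesis by (auto simp: coboundaries2_def)
qed

lemma pullback2_closed:
  assumes "group G" "f \<in> hom G H" "\<alpha> \<in> carrier (cocycles2 H)"
  shows "pullback2 G f \<alpha> \<in> carrier (cocycles2 G)"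
proof -
  interpret group G by fact
  show ?thesis
    using assms by (auto simp: cocycles2_def pullback2_def hom_def PiE_iff Pi_iff)
qed

lemma H2_map_class:
  assumes G: "group G" and H: "group H" and f: "f \<in> hom G H"
    and \<alpha>: "\<alpha> \<in> carrier (cocycles2 H)"
  shows "H2_map H G f (cohom_class H \<alpha>) = cohom_class G (pullback2 G f \<alpha>)"
proof -
  interpret ZG: comm_group "cocycles2 G" by (rule cocycles2_comm_group) fact
  interpret ZH: comm_group "cocycles2 H" by (rule cocycles2_comm_group) fact
  interpret BG: subgroup "coboundaries2 G" "cocycles2 G" by (rule coboundaries2_subgroup) fact
  interpret BH: subgroup "coboundaries2 H" "cocycles2 H" by (rule coboundaries2_subgroup) fact
  have "cohom_class G (pullback2 G f \<beta>) = cohom_class G (pullback2 G f \<alpha>)"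
    if \<beta>: "\<beta> \<in> cohom_class H \<alpha>" for \<beta>
  proof -
    obtain b where b: "b \<in> coboundaries2 H" "\<beta> = b \<otimes>\<^bsub>cocycles2 H\<^esub> \<alpha>"
      using \<beta> by (auto simp: cohom_class_def r_coset_def)
    have "pullback2 G f \<beta> = pullback2 G f b \<otimes>\<^bsub>cocycles2 G\<^esub> pullback2 G f \<alpha>"
      using f by (auto simp: b pullback2_def cocycles2_def hom_def restrict_def fun_eq_iff)
    then have "pullback2 G f \<beta> \<in> cohom_class G (pullback2 G f \<alpha>)"
      using pullback2_coboundary[OF G f b(1)] by (auto simp: cohom_class_def r_coset_def)
    then show ?thesis
      unfolding cohom_class_def
      using ZG.repr_independence[OF _ pullback2_closed[OF G f \<alpha>] BG.subgroup_axioms] by simp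
  qed
  moreover have "\<alpha> \<in> cohom_class H \<alpha>"
    unfolding cohom_class_def using ZH.rcos_self[OF \<alpha> BH.subgroup_axioms] .
  ultimately have "(\<lambda>\<alpha>. cohom_class G (pullback2 G f \<alpha>)) ` cohom_class H \<alpha>
      = {cohom_class G (pullback2 G f \<alpha>)}"
    by (metis (no_types, lifting) image_cong image_constant_conv empty_iff)
  moreover have "cohom_class H \<alpha> \<in> carrier (H2 H)"
    using \<alpha> by (auto simp: H2_def FactGroup_def RCOSETS_def cohom_class_def)
  ultimately show ?thesis by (simp add: H2_map_def)
qed

lemma twisted_basis_mult:
  assumes "group G" "finite (carrier G)" "g \<in> carrier G" "h \<in> carrier G"
  shows "twisted_basis G g \<otimes>\<^bsub>twisted_group_algebra G \<alpha>\<^esub> twisted_basis G h =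
    \<alpha> (g, h) \<odot>\<^bsub>twisted_group_algebra G \<alpha>\<^esub> twisted_basis G (g \<otimes>\<^bsub>G\<^esub> h)"
proof -
  interpret group G by fact
  have "(\<Sum>x\<in>carrier G. \<Sum>y\<in>carrier G. if x \<otimes>\<^bsub>G\<^esub> y = k
      then twisted_basis G g x * twisted_basis G h y * \<alpha> (x, y) else 0)
    = \<alpha> (g, h) * twisted_basis G (g \<otimes>\<^bsub>G\<^esub> h) k" (is "?L = ?R") if k: "k \<in> carrier G" for k
  proof -
    have "?L = (\<Sum>x\<in>carrier G. if x = g then
        (\<Sum>y\<in>carrier G. if y = h then (if g \<otimes>\<^bsub>G\<^esub> h = k then \<alpha> (g, h) else 0) else 0) else 0)"
      by (auto simp: twisted_basis_def intro!: sum.cong sum.neutral)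
    also have "\<dots> = ?R"
      using assms k by (auto simp: twisted_basis_def sum.delta)
    finally show ?thesis .
  qed
  then show ?thesis
    by (auto simp: twisted_group_algebra_def intro!: restrict_ext)
qed

end

theory Submission
  imports Defs
begin

text \<open>
  Let \<open>Q\<close> be the quotient of \<open>G\<close> by the central subgroup \<open>Z\<close>. A Fourier transform along the cosets of
  \<open>Z\<close> decomposes the algebra of \<open>G\<close> twisted by the inflation of \<open>\<alpha>\<close> into the product, over the
  characters \<open>\<chi>\<close> of \<open>Z\<close>, of the algebras of \<open>Q\<close> twisted by \<open>\<alpha> \<cdot> tra \<chi>\<close>. The compatibility of \<open>\<phi>\<close> and
  \<open>i\<close> with transgression matches the factors for \<open>G\<^sub>1\<close> with those for \<open>G\<^sub>2\<close> up to coboundaries. By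
  exactness, the isomorphism induced by \<open>\<phi>\<close> maps the kernel of inflation for \<open>G\<^sub>1\<close> onto that for
  \<open>G\<^sub>2\<close>, so it descends to an isomorphism between the second cohomology groups of \<open>G\<^sub>1\<close> and \<open>G\<^sub>2\<close>.
\<close>

section \<open>Characters of finite abelian groups\<close>

text \<open>Let \<open>n\<close> be the least positive exponent with \<open>g [^] n\<close> in
  \<open>K\<close>. Each \<open>n\<close>-th root \<open>c\<close> of
  \<open>\<chi> (g [^] n)\<close> gives an extension sending \<open>k \<otimes> g [^] m\<close> to
  \<open>\<chi> k * c ^ m\<close> on the subgroup generated by \<open>K\<close> and
  \<open>g\<close>. As \<open>n > 1\<close>, some root differs from 1, so
  \<open>\<psi> g \<noteq> 1\<close> can be arranged; this clause later separates points.\<close>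

lemma (in comm_group) character_extend_one:
  assumes fin: "finite (carrier G)" and K: "subgroup K G"
    and \<chi>: "\<chi> \<in> hom (G\<lparr>carrier := K\<rparr>) complex_units"
    and g: "g \<in> carrier G" "g \<notin> K"
  obtains L \<psi> where "subgroup L G" "K \<subseteq> L" "g \<in> L"
    "\<psi> \<in> hom (G\<lparr>carrier := L\<rparr>) complex_units" "\<forall>x\<in>K. \<psi> x = \<chi> x" "\<psi> g \<noteq> 1"
proof -
  interpret K: subgroup K G by (rule K)
  have \<chi>_nz: "\<chi> x \<noteq> 0" if "x \<in> K" for x
    using \<chi> that by (auto simp: hom_def complex_units_def)
  have \<chi>_mult: "\<chi> (x \<otimes> y) = \<chi> x * \<chi> y" if "x \<in> K" "y \<in> K" for x y
    using \<chi> that by (auto simp: hom_def complex_units_def)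
  have \<chi>_one: "\<chi> \<one> = 1"
    using \<chi>_mult[of \<one> \<one>] \<chi>_nz[of \<one>] by simp
  have pow_K: "x [^] (m::nat) \<in> K \<and> \<chi> (x [^] m) = \<chi> x ^ m" if "x \<in> K" for x m
    by (induction m) (use that in \<open>auto simp: \<chi>_one \<chi>_mult\<close>)
  define n where "n = (LEAST n::nat. 0 < n \<and> g [^] n \<in> K)"
  have ex: "0 < order G \<and> g [^] order G \<in> K"
    using fin g by (simp add: pow_order_eq_1 order_gt_0_iff_finite)
  have n: "0 < n" "g [^] n \<in> K"
    unfolding n_def using LeastI[of "\<lambda>n. 0 < n \<and> g [^] n \<in> K", OF ex] by auto
  have n_least: "r = 0" if "r < n" "g [^] r \<in> K" for r
    using that not_less_Least[of r "\<lambda>n. 0 < n \<and> g [^] n \<in> K"] by (auto simp: n_def)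
  have "n \<noteq> 1" using n g by auto
  \<comment> \<open>A nonzero complex number has exactly \<open>n\<close> distinct
    \<open>n\<close>-th roots, and for \<open>n > 1\<close> they cannot all equal 1.\<close>
  have "card {c. c ^ n = \<chi> (g [^] n)} = n"
    using n \<chi>_nz by (intro card_nth_roots) auto
  then have "\<not> {c. c ^ n = \<chi> (g [^] n)} \<subseteq> {1}"
    using n \<open>n \<noteq> 1\<close> card_mono[of "{1::complex}" "{c. c ^ n = \<chi> (g [^] n)}"] by auto
  then obtain c where c: "c ^ n = \<chi> (g [^] n)" "c \<noteq> 1" by auto
  have c_nz: "c \<noteq> 0" using c n \<chi>_nz[of "g [^] n"] by (auto simp: zero_power)
  \<comment> \<open>Division with remainder: \<open>g [^] (d mod n)\<close> lies in \<open>K\<close>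
    as well, and minimality of \<open>n\<close> forces the remainder to be 0, so \<open>d\<close> is
    a multiple of \<open>n\<close>.\<close>
  have c_pow: "\<chi> (g [^] d) = c ^ d" if "g [^] d \<in> K" for d
  proof -
    have split: "g [^] d = (g [^] n) [^] (d div n) \<otimes> g [^] (d mod n)"
      using g by (simp add: nat_pow_pow nat_pow_mult)
    have "g [^] (d mod n) = inv ((g [^] n) [^] (d div n)) \<otimes> g [^] d"
      unfolding split using g by (simp add: m_assoc[symmetric])
    then have "g [^] (d mod n) \<in> K"
      using that pow_K[OF n(2)] by simp
    then have "d mod n = 0" using n by (intro n_least) auto
    then show ?thesis
      using split g pow_K[OF n(2), of "d div n"] c
      by (metis div_mult_mod_eq add.right_neutral mult.commute nat_pow_0 nat_pow_closed power_mult r_one)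
  qed
  \<comment> \<open>The value does not depend on the chosen representation: cancelling
    \<open>g [^] m\<close> leaves a power of \<open>g\<close> lying in \<open>K\<close>, where
    \<open>c_pow\<close> applies.\<close>
  have well_le: "\<chi> k * c ^ m = \<chi> l * c ^ m'"
    if "k \<in> K" "l \<in> K" "k \<otimes> g [^] m = l \<otimes> g [^] m'" "m \<le> m'" for k l m m'
  proof -
    obtain d where d: "m' = d + m" using \<open>m \<le> m'\<close> by (metis le_iff_add add.commute)
    have "k \<otimes> g [^] m = (l \<otimes> g [^] d) \<otimes> g [^] m"
      using that g by (simp add: d nat_pow_mult m_assoc)
    then have k: "k = l \<otimes> g [^] d"
      using that g by (simp add: right_cancel)
    then have "g [^] d = inv l \<otimes> k"
      using that g by (simp add: m_assoc[symmetric])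
    then have "g [^] d \<in> K" using that by simp
    then show ?thesis using that by (simp add: k \<chi>_mult c_pow d power_add)
  qed
  have well: "\<chi> k * c ^ m = \<chi> l * c ^ m'"
    if "k \<in> K" "l \<in> K" "k \<otimes> g [^] m = l \<otimes> g [^] m'" for k l and m m' :: nat
    using well_le[of k l m m'] well_le[of l k m' m] that by (metis nat_le_linear)
  \<comment> \<open>Natural exponents suffice for closure under inverses, because in a finite group
    the inverse of \<open>y\<close> is \<open>y [^] (order G - 1)\<close>.\<close>
  define L where "L = {k \<otimes> g [^] m | k (m::nat). k \<in> K}"
  define \<psi> where "\<psi> x = (SOME w. \<exists>k\<in>K. \<exists>m::nat. x = k \<otimes> g [^] m \<and> w = \<chi> k * c ^ m)" for x
  have \<psi>: "\<psi> (k \<otimes> g [^] m) = \<chi> k * c ^ m" if "k \<in> K" for k and m :: nat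
    unfolding \<psi>_def
  proof (rule some1_equality, rule ex1I)
    show "\<exists>k'\<in>K. \<exists>m'. k \<otimes> g [^] m = k' \<otimes> g [^] m' \<and> \<chi> k * c ^ m = \<chi> k' * c ^ m'"
      using that by blast
    then show "\<exists>k'\<in>K. \<exists>m'. k \<otimes> g [^] m = k' \<otimes> g [^] m' \<and> \<chi> k * c ^ m = \<chi> k' * c ^ m'" .
  qed (use well that in metis)
  have L_mult: "(k \<otimes> g [^] m) \<otimes> (l \<otimes> g [^] m') = (k \<otimes> l) \<otimes> g [^] (m + m')"
    if "k \<in> K" "l \<in> K" for k l and m m' :: nat
    using that g by (simp add: nat_pow_mult[symmetric] m_ac)
  have K_L: "K \<subseteq> L"
    unfolding L_def using g by (force intro: exI[of _ "0::nat"])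
  have g_L: "g \<in> L"
    unfolding L_def using g by (force intro: exI[of _ "1::nat"] exI[of _ \<one>])
  have "subgroup L G"
  proof (rule subgroupI)
    show "L \<subseteq> carrier G" using g by (auto simp: L_def)
    show "L \<noteq> {}" using g_L by auto
    show "x \<otimes> y \<in> L" if "x \<in> L" "y \<in> L" for x y
      using that L_mult by (auto simp: L_def) (metis K.m_closed)
    show "inv x \<in> L" if x: "x \<in> L" for x
    proof -
      obtain k and m :: nat where km: "x = k \<otimes> g [^] m" "k \<in> K" using x unfolding L_def by blast
      let ?y = "g [^] m"
      have "?y [^] (order G - 1) \<otimes> ?y = ?y [^] order G"
        using ex g by (metis Suc_pred' nat_pow_Suc nat_pow_closed)
      also have "\<dots> = \<one>" using fin g by (simp add: pow_order_eq_1)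
      finally have "inv ?y = g [^] (m * (order G - 1))"
        using g by (simp add: inv_equality nat_pow_pow)
      then have "inv x = inv k \<otimes> g [^] (m * (order G - 1))"
        using km g by (simp add: inv_mult)
      then show ?thesis
        unfolding L_def using km(2) by blast
    qed
  qed
  moreover have "\<psi> \<in> hom (G\<lparr>carrier := L\<rparr>) complex_units"
  proof (rule homI)
    fix x y assume "x \<in> carrier (G\<lparr>carrier := L\<rparr>)" "y \<in> carrier (G\<lparr>carrier := L\<rparr>)"
    then obtain k l and m m' :: nat where
      x: "x = k \<otimes> g [^] m" "k \<in> K" and y: "y = l \<otimes> g [^] m'" "l \<in> K"
      unfolding L_def by auto
    show "\<psi> x \<in> carrier complex_units"
      using x(2) \<chi>_nz c_nz by (simp add: x(1) \<psi> complex_units_def)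
    show "\<psi> (x \<otimes>\<^bsub>G\<lparr>carrier := L\<rparr>\<^esub> y) = \<psi> x \<otimes>\<^bsub>complex_units\<^esub> \<psi> y"
      using x(2) y(2)
      by (simp add: x(1) y(1) L_mult \<psi> \<chi>_mult complex_units_def power_add)
  qed
  moreover have "\<forall>x\<in>K. \<psi> x = \<chi> x"
    using \<psi>[of _ 0] by simp
  moreover have "\<psi> g \<noteq> 1"
    using \<psi>[of \<one> 1] g c by (simp add: \<chi>_one)
  ultimately show thesis using that K_L g_L by blast
qed

text \<open>Induction on the number of elements outside \<open>K\<close>: while \<open>K\<close> is
  proper, \<open>character_extend_one\<close> adjoins a further element and this number
  drops.\<close>

lemma (in comm_group) character_extend:
  assumes "finite (carrier G)" "subgroup K G" "\<chi> \<in> hom (G\<lparr>carrier := K\<rparr>) complex_units"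
  shows "\<exists>\<psi> \<in> hom G complex_units. \<forall>x\<in>K. \<psi> x = \<chi> x"
  using assms(2,3)
proof (induction "card (carrier G) - card K" arbitrary: K \<chi> rule: less_induct)
  case less
  have sub: "K \<subseteq> carrier G" using less.prems(1) by (rule subgroup.subset)
  show ?case
  proof (cases "K = carrier G")
    case True
    then show ?thesis using less.prems(2) by (auto simp: hom_def)
  next
    case False
    then obtain g where g: "g \<in> carrier G" "g \<notin> K" using sub by blast
    obtain L \<psi> where L: "subgroup L G" "K \<subseteq> L" "g \<in> L"
      "\<psi> \<in> hom (G\<lparr>carrier := L\<rparr>) complex_units" "\<forall>x\<in>K. \<psi> x = \<chi> x" "\<psi> g \<noteq> 1"
      by (rule character_extend_one[OF assms(1) less.prems g])
    have "L \<subseteq> carrier G" using L(1) by (rule subgroup.subset)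
    then have "card K < card L" "card L \<le> card (carrier G)"
      using assms(1) L(2,3) g by (auto intro!: psubset_card_mono card_mono intro: finite_subset)
    then have "card (carrier G) - card L < card (carrier G) - card K" by simp
    from less.hyps[OF this L(1,4)] show ?thesis using L(2,5) by (metis subsetD)
  qed
qed

section \<open>Finiteness and orthogonality of characters\<close>

context comm_group
begin

lemma character_mult:
  "\<chi> \<in> carrier (Hom_units G) \<Longrightarrow> x \<in> carrier G \<Longrightarrow> y \<in> carrier G \<Longrightarrow> \<chi> (x \<otimes> y) = \<chi> x * \<chi> y"
  by (auto simp: Hom_units_def hom_def complex_units_def)

lemma character_nonzero:
  "\<chi> \<in> carrier (Hom_units G) \<Longrightarrow> x \<in> carrier G \<Longrightarrow> \<chi> x \<noteq> 0"
  by (auto simp: Hom_units_def hom_def complex_units_def)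

lemma character_one: "\<chi> \<in> carrier (Hom_units G) \<Longrightarrow> \<chi> \<one> = 1"
  using character_mult[of \<chi> \<one> \<one>] character_nonzero[of \<chi> \<one>] by simp

lemma character_divide_closed:
  "\<chi> \<in> carrier (Hom_units G) \<Longrightarrow> \<psi> \<in> carrier (Hom_units G) \<Longrightarrow>
    (\<lambda>x \<in> carrier G. \<chi> x / \<psi> x) \<in> carrier (Hom_units G)"
  by (auto simp: Hom_units_def hom_def complex_units_def Pi_iff)

lemma character_mult_closed:
  "\<chi> \<in> carrier (Hom_units G) \<Longrightarrow> \<psi> \<in> carrier (Hom_units G) \<Longrightarrow>
    (\<lambda>x \<in> carrier G. \<chi> x * \<psi> x) \<in> carrier (Hom_units G)"
  by (auto simp: Hom_units_def hom_def complex_units_def Pi_iff)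

lemma trivial_character: "(\<lambda>x \<in> carrier G. 1) \<in> carrier (Hom_units G)"
  by (auto simp: Hom_units_def hom_def complex_units_def)

text \<open>All values are roots of unity of exponent \<open>order G\<close>, so the characters lie
  in a finite function space.\<close>

lemma finite_characters:
  assumes fin: "finite (carrier G)"
  shows "finite (carrier (Hom_units G))"
proof (rule finite_subset)
  have pow: "\<chi> (x [^] (n::nat)) = \<chi> x ^ n" if "\<chi> \<in> carrier (Hom_units G)" "x \<in> carrier G" for \<chi> x n
    by (induction n) (use that in \<open>simp_all add: character_one character_mult\<close>)
  have "\<chi> x ^ order G = 1" if "\<chi> \<in> carrier (Hom_units G)" "x \<in> carrier G" for \<chi> x
    using pow[OF that, of "order G"] that fin by (simp add: pow_order_eq_1 character_one)
  then show "carrier (Hom_units G) \<subseteq> carrier G \<rightarrow>\<^sub>E {w. w ^ order G = 1}"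
    by (auto simp: Hom_units_def PiE_iff extensional_def)
  show "finite (carrier G \<rightarrow>\<^sub>E {w::complex. w ^ order G = 1})"
    using fin by (intro finite_PiE finite_roots_unity) (auto simp: order_gt_0_iff_finite Suc_le_eq)
qed

text \<open>The trivial character of the trivial subgroup extends by
  \<open>character_extend_one\<close> to one that is not 1 at \<open>z\<close>, and
  \<open>character_extend\<close> carries that one to the whole group.\<close>

lemma characters_separate:
  assumes fin: "finite (carrier G)" and z: "z \<in> carrier G" "z \<noteq> \<one>"
  obtains \<chi> where "\<chi> \<in> carrier (Hom_units G)" "\<chi> z \<noteq> 1"
proof -
  have "(\<lambda>_. 1) \<in> hom (G\<lparr>carrier := {\<one>}\<rparr>) complex_units"
    by (auto simp: hom_def complex_units_def)
  then obtain L \<psi> where L: "subgroup L G" "z \<in> L"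
    "\<psi> \<in> hom (G\<lparr>carrier := L\<rparr>) complex_units" "\<psi> z \<noteq> 1"
    using character_extend_one[OF fin triv_subgroup] z by (metis singletonD)
  obtain \<chi> where \<chi>: "\<chi> \<in> hom G complex_units" "\<forall>x\<in>L. \<chi> x = \<psi> x"
    using character_extend[OF fin L(1,3)] by blast
  have "restrict \<chi> (carrier G) \<in> carrier (Hom_units G)"
    using \<chi>(1) by (auto simp: Hom_units_def hom_def Pi_iff)
  moreover have "restrict \<chi> (carrier G) z \<noteq> 1" using \<chi>(2) L z by auto
  ultimately show thesis using that by blast
qed

text \<open>First orthogonality relation. Translating the summation variable by some
  \<open>w\<close> with \<open>\<chi> w \<noteq> 1\<close> multiplies the sum by
  \<open>\<chi> w\<close>, which forces it to vanish.\<close>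

lemma sum_character:
  assumes "finite (carrier G)" and \<chi>: "\<chi> \<in> carrier (Hom_units G)"
  shows "(\<Sum>x\<in>carrier G. \<chi> x) =
    (if \<chi> = (\<lambda>x \<in> carrier G. 1) then of_nat (card (carrier G)) else 0)"
proof (cases "\<chi> = (\<lambda>x \<in> carrier G. 1)")
  case False
  then obtain w where w: "w \<in> carrier G" "\<chi> w \<noteq> 1"
    using \<chi> by (auto simp: Hom_units_def extensional_def fun_eq_iff restrict_def split: if_splits)
  have "(\<Sum>x\<in>carrier G. \<chi> x) = (\<Sum>x\<in>carrier G. \<chi> (w \<otimes> x))"
    using w by (intro sum.reindex_bij_witness[of _ "\<lambda>x. w \<otimes> x" "\<lambda>x. inv w \<otimes> x"])
      (auto simp: m_assoc[symmetric])
  also have "\<dots> = \<chi> w * (\<Sum>x\<in>carrier G. \<chi> x)"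
    using \<chi> w by (simp add: character_mult sum_distrib_left)
  finally show ?thesis using w False by simp
qed simp

text \<open>Dual orthogonality relation. Multiplication by a character \<open>\<psi>\<close> with
  \<open>\<psi> z \<noteq> 1\<close> permutes the characters and scales the sum by
  \<open>\<psi> z\<close>.\<close>

lemma sum_characters:
  assumes fin: "finite (carrier G)" and z: "z \<in> carrier G"
  shows "(\<Sum>\<chi>\<in>carrier (Hom_units G). \<chi> z) =
    (if z = \<one> then of_nat (card (carrier (Hom_units G))) else 0)"
proof (cases "z = \<one>")
  case True
  then show ?thesis by (simp add: character_one)
next
  case False
  let ?A = "carrier (Hom_units G)"
  obtain \<psi> where \<psi>: "\<psi> \<in> ?A" "\<psi> z \<noteq> 1" using characters_separate[OF fin z False] .
  let ?m = "\<lambda>\<chi>. \<lambda>x \<in> carrier G. \<psi> x * \<chi> x"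
  have ext: "\<chi> = \<chi>'" if "\<chi> \<in> ?A" "\<chi>' \<in> ?A" "\<And>x. x \<in> carrier G \<Longrightarrow> \<chi> x = \<chi>' x" for \<chi> \<chi>'
    using that by (auto simp: Hom_units_def intro: extensionalityI)
  have nz: "\<psi> x \<noteq> 0" if "x \<in> carrier G" for x
    using that character_nonzero[OF \<psi>(1)] by simp
  have div: "?m (\<lambda>x \<in> carrier G. \<chi> x / \<psi> x) = \<chi>" if "\<chi> \<in> ?A" for \<chi>
    using that \<psi> nz by (intro ext character_mult_closed character_divide_closed) simp_all
  have mult: "(\<lambda>x \<in> carrier G. ?m \<chi> x / \<psi> x) = \<chi>" if "\<chi> \<in> ?A" for \<chi>
    using that \<psi> nz by (intro ext character_mult_closed character_divide_closed) simp_all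
  have "(\<Sum>\<chi>\<in>?A. \<chi> z) = (\<Sum>\<chi>\<in>?A. ?m \<chi> z)"
  proof (rule sum.reindex_bij_witness[of _ ?m "\<lambda>\<chi>. \<lambda>x \<in> carrier G. \<chi> x / \<psi> x"])
    fix \<chi> assume \<chi>: "\<chi> \<in> ?A"
    show "?m (\<lambda>x \<in> carrier G. \<chi> x / \<psi> x) = \<chi>" using div[OF \<chi>] .
    then show "?m (\<lambda>x \<in> carrier G. \<chi> x / \<psi> x) z = \<chi> z" by (rule fun_cong)
    show "(\<lambda>x \<in> carrier G. ?m \<chi> x / \<psi> x) = \<chi>" using mult[OF \<chi>] .
    show "(\<lambda>x \<in> carrier G. \<chi> x / \<psi> x) \<in> ?A" using \<chi> \<psi>(1) by (rule character_divide_closed)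
    show "?m \<chi> \<in> ?A" using \<psi>(1) \<chi> by (rule character_mult_closed)
  qed
  also have "\<dots> = \<psi> z * (\<Sum>\<chi>\<in>?A. \<chi> z)"
    using z by (simp add: sum_distrib_left)
  finally show ?thesis using \<psi> False by simp
qed

end

section \<open>Isomorphisms of algebras\<close>

lemma complex_algebra_isomorphicI:
  assumes "bij_betw F (carrier A) (carrier B)"
    and "\<And>f h. f \<in> carrier A \<Longrightarrow> h \<in> carrier A \<Longrightarrow> F (f \<otimes>\<^bsub>A\<^esub> h) = F f \<otimes>\<^bsub>B\<^esub> F h"
    and "\<And>f h. f \<in> carrier A \<Longrightarrow> h \<in> carrier A \<Longrightarrow> F (f \<oplus>\<^bsub>A\<^esub> h) = F f \<oplus>\<^bsub>B\<^esub> F h"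
    and "F \<one>\<^bsub>A\<^esub> = \<one>\<^bsub>B\<^esub>"
    and "\<And>c f. f \<in> carrier A \<Longrightarrow> F (c \<odot>\<^bsub>A\<^esub> f) = c \<odot>\<^bsub>B\<^esub> F f"
  shows "complex_algebra_isomorphic A B"
  unfolding complex_algebra_isomorphic_def
proof (rule bexI[of _ F])
  show "F \<in> ring_iso A B"
    using assms by (auto simp: ring_iso_def intro!: ring_hom_memI dest: bij_betwE)
qed (use assms in blast)

lemma complex_algebra_isomorphic_trans:
  assumes "complex_algebra_isomorphic A B" "complex_algebra_isomorphic B C"
  shows "complex_algebra_isomorphic A C"
proof -
  obtain F where F: "F \<in> ring_iso A B"
    "\<And>c x. x \<in> carrier A \<Longrightarrow> F (c \<odot>\<^bsub>A\<^esub> x) = c \<odot>\<^bsub>B\<^esub> F x"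
    using assms(1) by (auto simp: complex_algebra_isomorphic_def)
  obtain H where H: "H \<in> ring_iso B C"
    "\<And>c x. x \<in> carrier B \<Longrightarrow> H (c \<odot>\<^bsub>B\<^esub> x) = c \<odot>\<^bsub>C\<^esub> H x"
    using assms(2) by (auto simp: complex_algebra_isomorphic_def)
  have "H \<circ> F \<in> ring_iso A C" using F(1) H(1) by (rule ring_iso_set_trans)
  moreover have "F x \<in> carrier B" if "x \<in> carrier A" for x
    using F(1) that by (auto simp: ring_iso_def ring_hom_def)
  ultimately show ?thesis
    unfolding complex_algebra_isomorphic_def using F(2) H(2) by (intro bexI[of _ "H \<circ> F"]) auto
qed

text \<open>The records are not assumed to be algebras, so closure of \<open>A\<close> under its
  operations is an explicit hypothesis: the inverse function undoes \<open>F\<close> only on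
  \<open>carrier A\<close>, and sums, products and scalar multiples must stay there.\<close>

lemma complex_algebra_isomorphic_sym:
  assumes iso: "complex_algebra_isomorphic A B"
    and mult: "\<And>x y. x \<in> carrier A \<Longrightarrow> y \<in> carrier A \<Longrightarrow> x \<otimes>\<^bsub>A\<^esub> y \<in> carrier A"
    and add: "\<And>x y. x \<in> carrier A \<Longrightarrow> y \<in> carrier A \<Longrightarrow> x \<oplus>\<^bsub>A\<^esub> y \<in> carrier A"
    and one: "\<one>\<^bsub>A\<^esub> \<in> carrier A"
    and smult: "\<And>c x. x \<in> carrier A \<Longrightarrow> c \<odot>\<^bsub>A\<^esub> x \<in> carrier A"
  shows "complex_algebra_isomorphic B A"
proof -
  obtain F where F: "F \<in> ring_iso A B"
    "\<And>c x. x \<in> carrier A \<Longrightarrow> F (c \<odot>\<^bsub>A\<^esub> x) = c \<odot>\<^bsub>B\<^esub> F x"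
    using iso by (auto simp: complex_algebra_isomorphic_def)
  have bij: "bij_betw F (carrier A) (carrier B)" using F(1) by (simp add: ring_iso_def)
  let ?H = "inv_into (carrier A) F"
  have H: "?H (F x) = x" if "x \<in> carrier A" for x
    using bij that by (simp add: bij_betw_def)
  have hom: "F (x \<otimes>\<^bsub>A\<^esub> y) = F x \<otimes>\<^bsub>B\<^esub> F y" "F (x \<oplus>\<^bsub>A\<^esub> y) = F x \<oplus>\<^bsub>B\<^esub> F y" "F \<one>\<^bsub>A\<^esub> = \<one>\<^bsub>B\<^esub>"
    if "x \<in> carrier A" "y \<in> carrier A" for x y
    using F(1) that by (auto simp: ring_iso_def ring_hom_def)
  have surj: "\<exists>x\<in>carrier A. y = F x" if "y \<in> carrier B" for y
    using bij that by (auto simp: bij_betw_def)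
  show ?thesis
  proof (rule complex_algebra_isomorphicI[of ?H])
    show "bij_betw ?H (carrier B) (carrier A)" using bij by (rule bij_betw_inv_into)
    show "?H (f \<otimes>\<^bsub>B\<^esub> h) = ?H f \<otimes>\<^bsub>A\<^esub> ?H h" if "f \<in> carrier B" "h \<in> carrier B" for f h
      using surj[OF that(1)] surj[OF that(2)] H hom(1) mult by metis
    show "?H (f \<oplus>\<^bsub>B\<^esub> h) = ?H f \<oplus>\<^bsub>A\<^esub> ?H h" if "f \<in> carrier B" "h \<in> carrier B" for f h
      using surj[OF that(1)] surj[OF that(2)] H hom(2) add by metis
    show "?H \<one>\<^bsub>B\<^esub> = \<one>\<^bsub>A\<^esub>" using H[OF one] hom(3)[OF one one] by simp
    show "?H (c \<odot>\<^bsub>B\<^esub> f) = c \<odot>\<^bsub>A\<^esub> ?H f" if "f \<in> carrier B" for c f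
      using surj[OF that] H F(2) smult by metis
  qed
qed

lemma twisted_group_algebra_isomorphic_sym:
  "complex_algebra_isomorphic (twisted_group_algebra G \<alpha>) B \<Longrightarrow>
    complex_algebra_isomorphic B (twisted_group_algebra G \<alpha>)"
  by (erule complex_algebra_isomorphic_sym) (auto simp: twisted_group_algebra_def)

text \<open>Supplies the factors by which basis elements are rescaled when passing between
  cohomologous twists. The existential form allows such factors to be chosen for all characters at
  once by \<open>bchoice\<close>.\<close>

lemma cohom_classD:
  assumes "\<beta> \<in> cohom_class G \<alpha>"
  shows "\<exists>l. (\<forall>x\<in>carrier G. l x \<noteq> 0) \<and> (\<forall>x\<in>carrier G. \<forall>y\<in>carrier G.
      \<beta> (x, y) = l x * l y / l (x \<otimes>\<^bsub>G\<^esub> y) * \<alpha> (x, y))"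
proof -
  obtain l where l: "l \<in> carrier G \<rightarrow> carrier complex_units"
    and \<beta>: "\<beta> = coboundary2 G l \<otimes>\<^bsub>cocycles2 G\<^esub> \<alpha>"
    using assms by (auto simp: cohom_class_def r_coset_def coboundaries2_def)
  show ?thesis
    using l by (intro exI[of _ l]) (auto simp: \<beta> complex_units_def cocycles2_def coboundary2_def)
qed

text \<open>Rescaling of the basis: the basis element of \<open>g\<close> is sent to
  \<open>1 / l g\<close> times the basis element of \<open>g\<close>, where the coboundary of
  \<open>l\<close> relates \<open>\<beta>\<close> to \<open>\<alpha>\<close>.\<close>

lemma twisted_group_algebra_cohomologous:
  fixes G (structure)
  assumes "group G" and \<beta>: "\<beta> \<in> cohom_class G \<alpha>"
  shows "complex_algebra_isomorphic (twisted_group_algebra G \<alpha>) (twisted_group_algebra G \<beta>)"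
proof -
  interpret group G by fact
  obtain l where l: "\<And>x. x \<in> carrier G \<Longrightarrow> l x \<noteq> 0"
    and \<beta>: "\<And>x y. x \<in> carrier G \<Longrightarrow> y \<in> carrier G \<Longrightarrow>
      \<beta> (x, y) = l x * l y / l (x \<otimes>\<^bsub>G\<^esub> y) * \<alpha> (x, y)"
    using cohom_classD[OF \<beta>] by blast
  let ?A = "twisted_group_algebra G \<alpha>" and ?B = "twisted_group_algebra G \<beta>"
  let ?F = "\<lambda>f. \<lambda>x \<in> carrier G. f x / l x"
  show ?thesis
  proof (rule complex_algebra_isomorphicI[of ?F])
    show "bij_betw ?F (carrier ?A) (carrier ?B)"
      by (rule bij_betw_byWitness[where f' = "\<lambda>f. \<lambda>x \<in> carrier G. f x * l x"])
        (auto simp: twisted_group_algebra_def l fun_eq_iff PiE_iff extensional_def)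
    show "?F (f \<otimes>\<^bsub>?A\<^esub> h) = ?F f \<otimes>\<^bsub>?B\<^esub> ?F h" for f h
    proof -
      have "(\<Sum>x\<in>carrier G. \<Sum>y\<in>carrier G. if x \<otimes> y = k then f x * h y * \<alpha> (x, y) else 0) / l k =
        (\<Sum>x\<in>carrier G. \<Sum>y\<in>carrier G. if x \<otimes> y = k then ?F f x * ?F h y * \<beta> (x, y) else 0)"
        for k
        unfolding sum_divide_distrib by (intro sum.cong refl) (auto simp: \<beta> l)
      then show ?thesis by (simp add: twisted_group_algebra_def cong: restrict_cong)
    qed
    show "?F (f \<oplus>\<^bsub>?A\<^esub> h) = ?F f \<oplus>\<^bsub>?B\<^esub> ?F h" for f h
      by (auto simp: twisted_group_algebra_def add_divide_distrib)
    \<comment> \<open>At the identity the relation reads \<open>\<beta> (\<one>, \<one>) = l \<one>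
      * \<alpha> (\<one>, \<one>)\<close>, which matches the two units.\<close>
    show "?F \<one>\<^bsub>?A\<^esub> = \<one>\<^bsub>?B\<^esub>"
      by (auto simp: twisted_group_algebra_def twisted_basis_def \<beta> l fun_eq_iff
          divide_inverse_commute)
    show "?F (c \<odot>\<^bsub>?A\<^esub> f) = c \<odot>\<^bsub>?B\<^esub> ?F f" for c f
      by (auto simp: twisted_group_algebra_def)
  qed
qed

section \<open>Products of twisted group algebras\<close>

text \<open>The direct product of the algebras \<open>twisted_group_algebra Q (\<gamma> i)\<close> over \<open>i \<in> I\<close>.\<close>

definition twisted_family ::
  "'i set \<Rightarrow> ('a, 'm) monoid_scheme \<Rightarrow> ('i \<Rightarrow> 'a \<times> 'a \<Rightarrow> complex)
    \<Rightarrow> (complex, 'i \<times> 'a \<Rightarrow> complex) module" where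
  "twisted_family I Q \<gamma> =
    \<lparr>carrier = I \<times> carrier Q \<rightarrow>\<^sub>E UNIV,
     monoid.mult = (\<lambda>f h. \<lambda>(i, k) \<in> I \<times> carrier Q.
       \<Sum>x \<in> carrier Q. \<Sum>y \<in> carrier Q.
         if x \<otimes>\<^bsub>Q\<^esub> y = k then f (i, x) * h (i, y) * \<gamma> i (x, y) else 0),
     one = (\<lambda>(i, x) \<in> I \<times> carrier Q. if x = \<one>\<^bsub>Q\<^esub> then inverse (\<gamma> i (\<one>\<^bsub>Q\<^esub>, \<one>\<^bsub>Q\<^esub>)) else 0),
     ring.zero = (\<lambda>p \<in> I \<times> carrier Q. 0),
     ring.add = (\<lambda>f h. \<lambda>p \<in> I \<times> carrier Q. f p + h p),
     module.smult = (\<lambda>c f. \<lambda>p \<in> I \<times> carrier Q. c * f p)\<rparr>"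

text \<open>Factor \<open>j\<close> on the right is matched with factor \<open>a j\<close> on the
  left; within it \<open>\<phi>\<close> relabels the basis and \<open>l j\<close> rescales it. Both
  \<open>a\<close> and \<open>\<phi>\<close> point from right to left because coefficient functions
  are pulled back along them.\<close>

lemma twisted_family_isomorphic:
  assumes P: "group P" and Q: "group Q" and \<phi>: "\<phi> \<in> iso Q P" and a: "bij_betw a J I"
    and l: "\<And>j x. j \<in> J \<Longrightarrow> x \<in> carrier Q \<Longrightarrow> l j x \<noteq> 0"
    and \<delta>: "\<And>j x y. j \<in> J \<Longrightarrow> x \<in> carrier Q \<Longrightarrow> y \<in> carrier Q \<Longrightarrow>
      \<delta> j (x, y) = l j x * l j y / l j (x \<otimes>\<^bsub>Q\<^esub> y) * \<gamma> (a j) (\<phi> x, \<phi> y)"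
  shows "complex_algebra_isomorphic (twisted_family I P \<gamma>) (twisted_family J Q \<delta>)"
proof -
  interpret P: group P by (rule P)
  interpret Q: group Q by (rule Q)
  interpret \<phi>: group_hom Q P \<phi> using \<phi> by unfold_locales (auto simp: iso_def)
  have bij: "bij_betw \<phi> (carrier Q) (carrier P)" using \<phi> by (simp add: iso_def)
  have inj: "\<phi> x = \<phi> y \<longleftrightarrow> x = y" if "x \<in> carrier Q" "y \<in> carrier Q" for x y
    using bij that by (auto simp: bij_betw_def inj_on_def)
  have a_I: "a j \<in> I" if "j \<in> J" for j using a that by (auto simp: bij_betw_def)
  let ?A = "twisted_family I P \<gamma>" and ?B = "twisted_family J Q \<delta>"
  let ?F = "\<lambda>f. \<lambda>(j, x) \<in> J \<times> carrier Q. f (a j, \<phi> x) / l j x"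
  let ?a = "inv_into J a" and ?\<phi> = "inv_into (carrier Q) \<phi>"
  have inv: "?a i \<in> J" "a (?a i) = i" "?\<phi> u \<in> carrier Q" "\<phi> (?\<phi> u) = u"
    if "i \<in> I" "u \<in> carrier P" for i u
    using a bij that by (auto simp: bij_betw_def inv_into_into f_inv_into_f)
  have inv': "?a (a j) = j" "?\<phi> (\<phi> x) = x" if "j \<in> J" "x \<in> carrier Q" for j x
    using a bij that by (auto simp: bij_betw_def)
  show ?thesis
  proof (rule complex_algebra_isomorphicI[of ?F])
    show "bij_betw ?F (carrier ?A) (carrier ?B)"
    proof (rule bij_betw_byWitness[where
          f' = "\<lambda>h. \<lambda>(i, u) \<in> I \<times> carrier P. h (?a i, ?\<phi> u) * l (?a i) (?\<phi> u)"])
    qed (auto simp: twisted_family_def l a_I inv inv' fun_eq_iff PiE_iff extensional_def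
        split: if_splits)
    show "?F (f \<otimes>\<^bsub>?A\<^esub> h) = ?F f \<otimes>\<^bsub>?B\<^esub> ?F h" for f h
    proof -
      have "(\<Sum>u\<in>carrier P. \<Sum>v\<in>carrier P. if u \<otimes>\<^bsub>P\<^esub> v = \<phi> k
            then f (a j, u) * h (a j, v) * \<gamma> (a j) (u, v) else 0) / l j k =
          (\<Sum>x\<in>carrier Q. \<Sum>y\<in>carrier Q. if x \<otimes>\<^bsub>Q\<^esub> y = k
            then ?F f (j, x) * ?F h (j, y) * \<delta> j (x, y) else 0)"
        if "j \<in> J" "k \<in> carrier Q" for j k
        unfolding sum_divide_distrib sum.reindex_bij_betw[OF bij, symmetric]
        using that by (intro sum.cong refl) (auto simp: \<delta> l inj simp flip: \<phi>.hom_mult)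
      then show ?thesis by (auto simp: twisted_family_def a_I fun_eq_iff)
    qed
    show "?F (f \<oplus>\<^bsub>?A\<^esub> h) = ?F f \<oplus>\<^bsub>?B\<^esub> ?F h" for f h
      by (auto simp: twisted_family_def a_I fun_eq_iff add_divide_distrib)
    show "?F \<one>\<^bsub>?A\<^esub> = \<one>\<^bsub>?B\<^esub>"
      using inj[of _ "\<one>\<^bsub>Q\<^esub>"] by (auto simp: twisted_family_def a_I \<delta> l fun_eq_iff
          divide_inverse_commute)
    show "?F (c \<odot>\<^bsub>?A\<^esub> f) = c \<odot>\<^bsub>?B\<^esub> ?F f" for c f
      by (auto simp: twisted_family_def a_I fun_eq_iff)
  qed
qed

section \<open>Functoriality of the second cohomology group\<close>

text \<open>\<open>C\<close> and \<open>C'\<close> are the quotients of \<open>B\<close> and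
  \<open>B'\<close> by the kernels of \<open>g\<close> and \<open>g'\<close>. An isomorphism
  carrying one kernel onto the other descends to the quotients.\<close>

lemma epi_induced_iso:
  assumes B: "group B" "group B'" and C: "group C" "group C'"
    and g: "g \<in> epi B C" and g': "g' \<in> epi B' C'" and \<Phi>: "\<Phi> \<in> iso B B'"
    and ker: "\<Phi> ` kernel B C g = kernel B' C' g'"
  shows "\<exists>\<psi> \<in> iso C C'. \<forall>b \<in> carrier B. \<psi> (g b) = g' (\<Phi> b)"
proof -
  interpret g: group_hom B C g
    using B C g by (auto simp: epi_def group_hom_def group_hom_axioms_def)
  interpret g': group_hom B' C' g'
    using B C g' by (auto simp: epi_def group_hom_def group_hom_axioms_def)
  interpret \<Phi>: group_hom B B' \<Phi>
    using B \<Phi> by (auto simp: iso_def group_hom_def group_hom_axioms_def)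
  have bij: "bij_betw \<Phi> (carrier B) (carrier B')" using \<Phi> by (simp add: iso_def)
  have surj: "g ` carrier B = carrier C" "g' ` carrier B' = carrier C'"
    using g g' by (auto simp: epi_def)
  have ker_iff: "\<Phi> b \<in> kernel B' C' g' \<longleftrightarrow> b \<in> kernel B C g" if "b \<in> carrier B" for b
    using bij that unfolding ker[symmetric] bij_betw_def
    by (intro inj_on_image_mem_iff[of _ "carrier B"]) (auto simp: kernel_def)
  \<comment> \<open>One direction makes the descended map well defined, the other makes it
    injective.\<close>
  have eq_iff: "g b = g c \<longleftrightarrow> g' (\<Phi> b) = g' (\<Phi> c)" if "b \<in> carrier B" "c \<in> carrier B" for b c
  proof -
    have "g b = g c \<longleftrightarrow> b \<otimes>\<^bsub>B\<^esub> inv\<^bsub>B\<^esub> c \<in> kernel B C g"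
      using that by (simp add: kernel_def g.H.inv_solve_right')
    moreover have "g' (\<Phi> b) = g' (\<Phi> c) \<longleftrightarrow> \<Phi> (b \<otimes>\<^bsub>B\<^esub> inv\<^bsub>B\<^esub> c) \<in> kernel B' C' g'"
      using that by (simp add: kernel_def g'.H.inv_solve_right')
    ultimately show ?thesis using that ker_iff[of "b \<otimes>\<^bsub>B\<^esub> inv\<^bsub>B\<^esub> c"] by simp
  qed
  define \<psi> where "\<psi> c = g' (\<Phi> (inv_into (carrier B) g c))" for c
  have \<psi>: "\<psi> (g b) = g' (\<Phi> b)" if "b \<in> carrier B" for b
    using that eq_iff[of "inv_into (carrier B) g (g b)" b]
    by (simp add: \<psi>_def inv_into_into f_inv_into_f)
  have "\<psi> \<in> hom C C'"
  proof (rule homI)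
    fix c d assume "c \<in> carrier C" "d \<in> carrier C"
    then obtain b e where "b \<in> carrier B" "c = g b" "e \<in> carrier B" "d = g e"
      using surj by blast
    then show "\<psi> c \<in> carrier C'" "\<psi> (c \<otimes>\<^bsub>C\<^esub> d) = \<psi> c \<otimes>\<^bsub>C'\<^esub> \<psi> d"
      by (auto simp: \<psi> simp flip: g.hom_mult)
  qed
  moreover have "inj_on \<psi> (carrier C)"
    unfolding surj(1)[symmetric] by (auto simp: inj_on_def \<psi> eq_iff)
  moreover have "\<psi> ` carrier C = carrier C'"
  proof -
    have "\<psi> ` g ` carrier B = g' ` \<Phi> ` carrier B"
      unfolding image_image using \<psi> by (rule image_cong[OF refl])
    also have "\<Phi> ` carrier B = carrier B'" using bij by (simp add: bij_betw_def)
    finally show ?thesis using surj by simp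
  qed
  ultimately show ?thesis using \<psi> by (auto simp: iso_def bij_betw_def intro!: bexI[of _ \<psi>])
qed

section \<open>Induced maps between second cohomology groups\<close>

lemma carrier_H2: "carrier (H2 G) = cohom_class G ` carrier (cocycles2 G)"
  by (auto simp: H2_def FactGroup_def RCOSETS_def cohom_class_def)

lemma cohom_class_self:
  assumes "group G" "\<alpha> \<in> carrier (cocycles2 G)"
  shows "\<alpha> \<in> cohom_class G \<alpha>"
proof -
  interpret Z: comm_group "cocycles2 G" by (rule cocycles2_comm_group) fact
  show ?thesis
    unfolding cohom_class_def using assms by (intro Z.rcos_self coboundaries2_subgroup)
qed

lemma cohom_class_mult:
  assumes "group G" "\<alpha> \<in> carrier (cocycles2 G)" "\<beta> \<in> carrier (cocycles2 G)"
  shows "cohom_class G \<alpha> \<otimes>\<^bsub>H2 G\<^esub> cohom_class G \<beta> = cohom_class G (\<alpha> \<otimes>\<^bsub>cocycles2 G\<^esub> \<beta>)"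
proof -
  interpret Z: comm_group "cocycles2 G" by (rule cocycles2_comm_group) fact
  have "coboundaries2 G \<lhd> cocycles2 G"
    using assms by (intro Z.subgroup_imp_normal coboundaries2_subgroup)
  then show ?thesis
    using assms by (simp add: H2_def FactGroup_def cohom_class_def normal.rcos_sum)
qed

lemma H2_map_hom:
  assumes G: "group G" and H: "group H" and f: "f \<in> hom G H"
  shows "H2_map H G f \<in> hom (H2 H) (H2 G)"
proof (rule homI)
  fix c d assume "c \<in> carrier (H2 H)" "d \<in> carrier (H2 H)"
  then obtain \<alpha> \<beta> where \<alpha>: "\<alpha> \<in> carrier (cocycles2 H)" "c = cohom_class H \<alpha>"
    and \<beta>: "\<beta> \<in> carrier (cocycles2 H)" "d = cohom_class H \<beta>"
    by (auto simp: carrier_H2)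
  note closed = pullback2_closed[OF G f]
  interpret ZH: comm_group "cocycles2 H" by (rule cocycles2_comm_group) fact
  show "H2_map H G f c \<in> carrier (H2 G)"
    using \<alpha> closed by (simp add: H2_map_class[OF G H f] carrier_H2)
  have "pullback2 G f (\<alpha> \<otimes>\<^bsub>cocycles2 H\<^esub> \<beta>) =
      pullback2 G f \<alpha> \<otimes>\<^bsub>cocycles2 G\<^esub> pullback2 G f \<beta>"
    using f by (auto simp: pullback2_def cocycles2_def hom_def fun_eq_iff)
  then show "H2_map H G f (c \<otimes>\<^bsub>H2 H\<^esub> d) = H2_map H G f c \<otimes>\<^bsub>H2 G\<^esub> H2_map H G f d"
    using \<alpha> \<beta> closed by (simp add: H2_map_class[OF G H f] cohom_class_mult G H)
qed

text \<open>Pulling back along \<open>f\<close> and then along \<open>h\<close> returns each cocycle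
  itself, already before passing to classes. Applied in both directions, this gives the bijectivity
  in \<open>H2_map_iso\<close>.\<close>

lemma H2_map_inverse:
  assumes G: "group G" and H: "group H" and f: "f \<in> hom G H" and h: "h \<in> hom H G"
    and hf: "\<And>x. x \<in> carrier H \<Longrightarrow> f (h x) = x" and c: "c \<in> carrier (H2 H)"
  shows "H2_map G H h (H2_map H G f c) = c"
proof -
  obtain \<alpha> where \<alpha>: "\<alpha> \<in> carrier (cocycles2 H)" "c = cohom_class H \<alpha>"
    using c by (auto simp: carrier_H2)
  have "pullback2 H h (pullback2 G f \<alpha>) = \<alpha>"
    using \<alpha> h by (auto simp: pullback2_def cocycles2_def hom_def hf fun_eq_iff PiE_iff extensional_def)
  then show ?thesis
    using \<alpha> pullback2_closed[OF G f] by (simp add: H2_map_class[OF G H f] H2_map_class[OF H G h])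
qed

lemma H2_map_iso:
  assumes G: "group G" and H: "group H" and f: "f \<in> iso G H"
  shows "H2_map H G f \<in> iso (H2 H) (H2 G)"
proof -
  let ?h = "inv_into (carrier G) f"
  have f': "f \<in> hom G H" "bij_betw f (carrier G) (carrier H)" using f by (auto simp: iso_def)
  have h: "?h \<in> hom H G"
    using group.iso_set_sym[OF G f] by (simp add: iso_def)
  have "bij_betw (H2_map H G f) (carrier (H2 H)) (carrier (H2 G))"
    using f' H2_map_hom[OF G H f'(1)] H2_map_hom[OF H G h]
    by (intro bij_betw_byWitness[where f' = "H2_map G H ?h"] ballI
        H2_map_inverse[OF G H f'(1) h] H2_map_inverse[OF H G h f'(1)])
      (auto simp: bij_betw_def f_inv_into_f hom_def)
  then show ?thesis using H2_map_hom[OF G H f'(1)] by (simp add: iso_def)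
qed

section \<open>Pullback of characters\<close>

lemma Hom_units_compose_closed:
  assumes "group H" "f \<in> hom H K" "\<chi> \<in> carrier (Hom_units K)"
  shows "compose (carrier H) \<chi> f \<in> carrier (Hom_units H)"
proof -
  interpret group H by fact
  show ?thesis using assms(2,3) by (auto simp: Hom_units_def hom_def compose_def Pi_iff)
qed

lemma Hom_units_compose_bij:
  assumes H: "group H" and K: "group K" and i: "i \<in> iso H K"
  shows "bij_betw (\<lambda>\<chi>. compose (carrier H) \<chi> i) (carrier (Hom_units K)) (carrier (Hom_units H))"
proof -
  let ?j = "inv_into (carrier H) i"
  have i': "i \<in> hom H K" "bij_betw i (carrier H) (carrier K)" using i by (auto simp: iso_def)
  have j: "?j \<in> hom K H" using group.iso_set_sym[OF H i] by (simp add: iso_def)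
  have ji: "?j (i x) = x" if "x \<in> carrier H" for x
    using i'(2) that by (simp add: bij_betw_def)
  have ij: "i (?j y) = y" if "y \<in> carrier K" for y
    using i'(2) that by (simp add: bij_betw_def f_inv_into_f)
  show ?thesis
  proof (rule bij_betw_byWitness[where f' = "\<lambda>\<chi>. compose (carrier K) \<chi> ?j"])
    show "\<forall>\<chi>\<in>carrier (Hom_units K). compose (carrier K) (compose (carrier H) \<chi> i) ?j = \<chi>"
      using j by (auto simp: compose_def Hom_units_def hom_def Pi_iff extensional_def fun_eq_iff ij)
    show "\<forall>\<chi>\<in>carrier (Hom_units H). compose (carrier H) (compose (carrier K) \<chi> ?j) i = \<chi>"
      using i'(1) by (auto simp: compose_def Hom_units_def hom_def Pi_iff extensional_def fun_eq_iff ji)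
  qed (use Hom_units_compose_closed[OF H i'(1)] Hom_units_compose_closed[OF K j] in auto)
qed

section \<open>Fourier transform along a central subgroup\<close>

locale central_extension = group G for G (structure) +
  fixes Z :: "'a set" and \<mu> :: "'a set \<Rightarrow> 'a"
  assumes finite_G: "finite (carrier G)"
    and central_Z: "central_subgroup Z G"
    and section_\<mu>: "is_section G Z \<mu>"
begin

abbreviation "Q \<equiv> G Mod Z"
abbreviation "chars \<equiv> carrier (Hom_units (G\<lparr>carrier := Z\<rparr>))"

text \<open>Twisting an algebra requires a function rather than a class, so the representative
  occurring in \<open>transgression\<close> gets its own name.\<close>

definition tra_cocycle :: "('a \<Rightarrow> complex) \<Rightarrow> 'a set \<times> 'a set \<Rightarrow> complex" where
  "tra_cocycle \<chi> = (\<lambda>(x, y) \<in> carrier Q \<times> carrier Q. \<chi> (\<mu> x \<otimes> \<mu> y \<otimes> inv (\<mu> (x \<otimes>\<^bsub>Q\<^esub> y))))"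

text \<open>Writing \<open>g = z \<otimes> \<mu> x\<close> with \<open>x\<close> the coset of
  \<open>g\<close> and \<open>z\<close> in \<open>Z\<close>, this is \<open>\<chi> z\<close>. It is
  multiplicative up to \<open>tra_cocycle \<chi>\<close> and supplies the weights of the Fourier
  transform.\<close>

definition lift :: "('a \<Rightarrow> complex) \<Rightarrow> 'a \<Rightarrow> complex" where
  "lift \<chi> g = \<chi> (g \<otimes> inv (\<mu> (Z #> g)))"

lemma transgression_eq: "transgression G Z \<mu> \<chi> = cohom_class Q (tra_cocycle \<chi>)"
  by (simp add: transgression_def tra_cocycle_def)

lemma subgroup_Z: "subgroup Z G"
  using central_Z by (simp add: central_subgroup_def)

sublocale Z: subgroup Z G by (rule subgroup_Z)

lemma central: "z \<in> Z \<Longrightarrow> g \<in> carrier G \<Longrightarrow> z \<otimes> g = g \<otimes> z"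
  using central_Z by (simp add: central_subgroup_def)

sublocale Z_group: comm_group "G\<lparr>carrier := Z\<rparr>"
  using group.group_comm_groupI[OF subgroup.subgroup_is_group[OF subgroup_Z is_group]] central
  by simp

lemma finite_Z: "finite Z"
  using finite_G Z.subset by (rule finite_subset[rotated])

lemma normal_Z: "Z \<lhd> G"
proof (rule normal_invI[OF subgroup_Z])
  fix x h assume "x \<in> carrier G" "h \<in> Z"
  then show "x \<otimes> h \<otimes> inv x \<in> Z" by (simp add: central[symmetric] m_assoc)
qed

sublocale Q: group Q by (rule normal.factorgroup_is_group[OF normal_Z])

declare mult_FactGroup [simp del] one_FactGroup [simp del]

section \<open>Cosets of the central subgroup\<close>

lemma Q_mult: "g \<in> carrier G \<Longrightarrow> h \<in> carrier G \<Longrightarrow> (Z #> g) \<otimes>\<^bsub>Q\<^esub> (Z #> h) = Z #> (g \<otimes> h)"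
  using normal.rcos_sum[OF normal_Z] by (simp add: mult_FactGroup)

lemma coset_closed: "g \<in> carrier G \<Longrightarrow> Z #> g \<in> carrier Q"
  by (auto simp: FactGroup_def RCOSETS_def)

lemma coset_hom: "(\<lambda>g. Z #> g) \<in> hom G Q"
  by (rule homI) (simp_all add: coset_closed Q_mult)

lemma \<mu>_closed: "x \<in> carrier Q \<Longrightarrow> \<mu> x \<in> carrier G"
  and coset_\<mu>: "x \<in> carrier Q \<Longrightarrow> Z #> \<mu> x = x"
  using section_\<mu> by (auto simp: is_section_def)

lemma coset_absorb: "z \<in> Z \<Longrightarrow> g \<in> carrier G \<Longrightarrow> Z #> (z \<otimes> g) = Z #> g"
  using coset_mult_assoc[of Z z g] Z.subset coset_join2[OF _ subgroup_Z, of z] by simp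

lemma in_coset_iff:
  assumes "x \<in> carrier Q"
  shows "g \<in> x \<longleftrightarrow> g \<in> carrier G \<and> Z #> g = x"
proof -
  have "x \<subseteq> carrier G"
    using r_coset_subset_G[OF Z.subset \<mu>_closed[OF assms]] by (simp add: coset_\<mu>[OF assms])
  moreover have "Z #> g = x" if "g \<in> x"
    using repr_independence[of g Z "\<mu> x"] that assms subgroup_Z by (simp add: \<mu>_closed coset_\<mu>)
  moreover have "g \<in> Z #> g" if "g \<in> carrier G" using that subgroup_Z by (rule rcos_self)
  ultimately show ?thesis by auto
qed

text \<open>The cosets are the fibres of the quotient map and partition the group. Giving
  \<open>f\<close> the coset as a separate argument lets factors that depend only on the coset be
  written as such.\<close>

lemma sum_cosets:
  "(\<Sum>x\<in>carrier Q. \<Sum>g\<in>x. f x g) = (\<Sum>g\<in>carrier G. f (Z #> g) g :: complex)"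
proof -
  have "(\<Sum>g\<in>x. f x g) = (\<Sum>g | g \<in> carrier G \<and> Z #> g = x. f (Z #> g) g)"
    if "x \<in> carrier Q" for x
    using in_coset_iff[OF that] by (intro sum.cong) auto
  then have "(\<Sum>x\<in>carrier Q. \<Sum>g\<in>x. f x g) =
      (\<Sum>x\<in>carrier Q. \<Sum>g | g \<in> carrier G \<and> Z #> g = x. f (Z #> g) g)"
    by (rule sum.cong[OF refl])
  also have "\<dots> = (\<Sum>g\<in>carrier G. f (Z #> g) g)"
    using finite_G by (intro sum.group) (auto simp: carrier_FactGroup)
  finally show ?thesis .
qed

lemma coset_quotient:
  assumes "g \<in> carrier G" "h \<in> carrier G" "Z #> g = Z #> h"
  shows "g \<otimes> inv h \<in> Z"
proof -
  have "g \<in> Z #> h" using assms rcos_self[OF _ subgroup_Z, of g] by simp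
  then show ?thesis
    using assms by (auto simp: r_coset_def m_assoc)
qed

section \<open>Lifted characters and the transgression cocycle\<close>

lemma lift_arg: "g \<in> carrier G \<Longrightarrow> g \<otimes> inv (\<mu> (Z #> g)) \<in> Z"
  by (simp add: coset_quotient \<mu>_closed coset_\<mu> coset_closed)

lemmas char_mult = Z_group.character_mult[simplified]
  and char_nonzero = Z_group.character_nonzero[simplified]
  and char_one = Z_group.character_one[simplified]

lemma lift_nonzero: "\<chi> \<in> chars \<Longrightarrow> g \<in> carrier G \<Longrightarrow> lift \<chi> g \<noteq> 0"
  by (simp add: lift_def char_nonzero lift_arg)

text \<open>Multiplication by \<open>z\<close> changes neither the coset nor its chosen
  representative, only the component in \<open>Z\<close>.\<close>

lemma lift_absorb:
  assumes "\<chi> \<in> chars" "z \<in> Z" "g \<in> carrier G"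
  shows "lift \<chi> (z \<otimes> g) = \<chi> z * lift \<chi> g"
  using assms by (simp add: lift_def coset_absorb m_assoc \<mu>_closed coset_closed char_mult lift_arg)

lemma lift_same_coset:
  assumes "\<chi> \<in> chars" "g \<in> carrier G" "h \<in> carrier G" "Z #> g = Z #> h"
  shows "lift \<chi> g = \<chi> (g \<otimes> inv h) * lift \<chi> h"
  using lift_absorb[OF assms(1) coset_quotient[OF assms(2-4)] assms(3)] assms
  by (simp add: m_assoc)

lemma lift_\<mu>: "\<chi> \<in> chars \<Longrightarrow> x \<in> carrier Q \<Longrightarrow> lift \<chi> (\<mu> x) = 1"
  by (simp add: lift_def coset_\<mu> \<mu>_closed char_one)

text \<open>The pullback of \<open>tra_cocycle \<chi>\<close> to \<open>G\<close> is a coboundary.\<close>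

lemma lift_mult:
  assumes \<chi>: "\<chi> \<in> chars" and g: "g \<in> carrier G" and h: "h \<in> carrier G"
  shows "lift \<chi> (g \<otimes> h) = lift \<chi> g * lift \<chi> h * tra_cocycle \<chi> (Z #> g, Z #> h)"
proof -
  let ?x = "\<mu> (Z #> g)" and ?y = "\<mu> (Z #> h)"
  let ?z = "g \<otimes> inv ?x" and ?w = "h \<otimes> inv ?y"
  have xy: "?x \<in> carrier G" "?y \<in> carrier G" using g h by (simp_all add: \<mu>_closed coset_closed)
  have zw: "?z \<in> Z" "?w \<in> Z" using g h by (simp_all add: lift_arg)
  have "g \<otimes> h = (?z \<otimes> ?x) \<otimes> (?w \<otimes> ?y)" using g h xy by (simp add: m_assoc)
  \<comment> \<open>Centrality of \<open>?w\<close> moves it past the representative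
    \<open>?x\<close>. What remains, the lift of \<open>?x \<otimes> ?y\<close>, is by definition
    the transgression cocycle at the two cosets.\<close>
  also have "\<dots> = (?z \<otimes> ?w) \<otimes> (?x \<otimes> ?y)"
  proof -
    have "?x \<otimes> (?w \<otimes> ?y) = ?w \<otimes> (?x \<otimes> ?y)"
      using central[OF zw(2) xy(1)] xy Z.mem_carrier[OF zw(2)] by (simp only: m_assoc[symmetric])
    then show ?thesis
      using xy Z.mem_carrier[OF zw(1)] Z.mem_carrier[OF zw(2)] by (simp only: m_assoc m_closed)
  qed
  finally have "lift \<chi> (g \<otimes> h) = \<chi> (?z \<otimes> ?w) * lift \<chi> (?x \<otimes> ?y)"
    using \<chi> xy Z.m_closed[OF zw] by (simp only: lift_absorb m_closed)
  moreover have "\<chi> (?z \<otimes> ?w) = lift \<chi> g * lift \<chi> h"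
    using \<chi> zw by (simp only: char_mult lift_def)
  moreover have "lift \<chi> (?x \<otimes> ?y) = tra_cocycle \<chi> (Z #> g, Z #> h)"
    using g h xy by (simp add: lift_def tra_cocycle_def coset_closed Q_mult[symmetric] coset_\<mu>)
  ultimately show ?thesis by simp
qed

lemma tra_cocycle_lift:
  assumes "\<chi> \<in> chars" "g \<in> carrier G" "h \<in> carrier G"
  shows "tra_cocycle \<chi> (Z #> g, Z #> h) = lift \<chi> (g \<otimes> h) / (lift \<chi> g * lift \<chi> h)"
  using assms by (simp add: lift_mult lift_nonzero)

text \<open>Every coset has a representative in \<open>G\<close>, so \<open>tra_cocycle_lift\<close>
  expresses all values through \<open>lift\<close>; the cocycle identity becomes a cancellation
  combined with associativity in \<open>G\<close>.\<close>

lemma tra_cocycle_closed: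
  assumes \<chi>: "\<chi> \<in> chars"
  shows "tra_cocycle \<chi> \<in> carrier (cocycles2 Q)"
proof -
  have lift: "\<exists>g\<in>carrier G. x = Z #> g" if "x \<in> carrier Q" for x
    using that \<mu>_closed coset_\<mu> by metis
  have "tra_cocycle \<chi> (x, y) \<noteq> 0" if "x \<in> carrier Q" "y \<in> carrier Q" for x y
    using lift[OF that(1)] lift[OF that(2)] \<chi> by (auto simp: tra_cocycle_lift lift_nonzero)
  then have "tra_cocycle \<chi> \<in> carrier Q \<times> carrier Q \<rightarrow>\<^sub>E carrier complex_units"
    by (auto simp: complex_units_def tra_cocycle_def split: if_splits)
  moreover have "tra_cocycle \<chi> (x, y) * tra_cocycle \<chi> (x \<otimes>\<^bsub>Q\<^esub> y, z) =
      tra_cocycle \<chi> (x, y \<otimes>\<^bsub>Q\<^esub> z) * tra_cocycle \<chi> (y, z)"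
    if xyz: "x \<in> carrier Q" "y \<in> carrier Q" "z \<in> carrier Q" for x y z
  proof -
    obtain g h k where ghk: "g \<in> carrier G" "h \<in> carrier G" "k \<in> carrier G"
      and "x = Z #> g" "y = Z #> h" "z = Z #> k"
      using lift xyz by metis
    then show ?thesis
      using \<chi> by (simp add: Q_mult tra_cocycle_lift lift_nonzero m_assoc)
  qed
  ultimately show ?thesis by (simp add: cocycles2_def)
qed

text \<open>In the factor of \<open>\<chi>\<close>, the basis element of \<open>g\<close> goes to
  \<open>lift \<chi> g\<close> times the basis element of its coset. On each coset this is the
  Fourier transform on \<open>Z\<close>, with base point \<open>\<mu> q\<close>.\<close>

definition fourier :: "('a \<Rightarrow> complex) \<Rightarrow> ('a \<Rightarrow> complex) \<times> 'a set \<Rightarrow> complex" where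
  "fourier f = (\<lambda>(\<chi>, q) \<in> chars \<times> carrier Q. \<Sum>g\<in>q. f g * lift \<chi> g)"

text \<open>Within a coset,
  \<open>lift \<chi> g / lift \<chi> k = \<chi> (g \<otimes> inv k)\<close>, so summing over
  \<open>\<chi>\<close> leaves only the term \<open>g = k\<close>. This yields injectivity.\<close>

lemma fourier_inversion:
  assumes k: "k \<in> carrier G"
  shows "(\<Sum>\<chi>\<in>chars. fourier f (\<chi>, Z #> k) / lift \<chi> k) = of_nat (card chars) * f k"
proof -
  have "(\<Sum>\<chi>\<in>chars. fourier f (\<chi>, Z #> k) / lift \<chi> k) =
      (\<Sum>\<chi>\<in>chars. \<Sum>g\<in>Z #> k. f g * \<chi> (g \<otimes> inv k))"
  proof (intro sum.cong refl)
    fix \<chi> assume \<chi>: "\<chi> \<in> chars"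
    have "f g * lift \<chi> g / lift \<chi> k = f g * \<chi> (g \<otimes> inv k)" if "g \<in> Z #> k" for g
      using lift_same_coset[OF \<chi> _ k, of g] lift_nonzero[OF \<chi> k] that
      by (simp add: in_coset_iff coset_closed k)
    then show "fourier f (\<chi>, Z #> k) / lift \<chi> k = (\<Sum>g\<in>Z #> k. f g * \<chi> (g \<otimes> inv k))"
      using \<chi> k by (simp add: fourier_def coset_closed sum_divide_distrib)
  qed
  also have "\<dots> = (\<Sum>g\<in>Z #> k. f g * (\<Sum>\<chi>\<in>chars. \<chi> (g \<otimes> inv k)))"
    by (subst sum.swap) (simp add: sum_distrib_left)
  also have "\<dots> = (\<Sum>g\<in>Z #> k. if g = k then f k * of_nat (card chars) else 0)"
  proof (rule sum.cong)
    fix g assume "g \<in> Z #> k"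
    then have g: "g \<in> carrier G" "Z #> g = Z #> k" using k by (simp_all add: in_coset_iff coset_closed)
    have "g \<otimes> inv k = \<one> \<longleftrightarrow> g = k" using g(1) k by (simp add: inv_solve_right')
    moreover have "(\<Sum>\<chi>\<in>chars. \<chi> (g \<otimes> inv k)) =
        (if g \<otimes> inv k = \<one> then of_nat (card chars) else 0)"
      using Z_group.sum_characters[of "g \<otimes> inv k"] coset_quotient[OF g(1) k g(2)]
      by (simp add: finite_Z)
    ultimately show "f g * (\<Sum>\<chi>\<in>chars. \<chi> (g \<otimes> inv k)) =
        (if g = k then f k * of_nat (card chars) else 0)" by simp
  qed simp
  also have "\<dots> = of_nat (card chars) * f k"
    using k finite_G finite_subset[of "Z #> k" "carrier G"] rcos_self[OF k subgroup_Z]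
    by (simp add: sum.delta r_coset_subset_G Z.subset mult.commute)
  finally show ?thesis .
qed

text \<open>This yields surjectivity. Here the orthogonality is that of a sum over \<open>Z\<close>
  of the character \<open>\<psi> / \<chi>\<close>, which explains the factor
  \<open>card Z\<close>.\<close>

lemma fourier_inverse:
  fixes H :: "('a \<Rightarrow> complex) \<times> 'a set \<Rightarrow> complex"
  assumes \<psi>: "\<psi> \<in> chars" and q: "q \<in> carrier Q"
  shows "fourier (\<lambda>k \<in> carrier G. (\<Sum>\<chi>\<in>chars. H (\<chi>, Z #> k) / lift \<chi> k) / of_nat (card Z)) (\<psi>, q)
    = H (\<psi>, q)"
proof -
  have card_Z: "card Z \<noteq> 0" using finite_Z Z.one_closed by (metis card_0_eq empty_iff)
  have inner: "(\<Sum>g\<in>q. lift \<psi> g / lift \<chi> g) = (if \<chi> = \<psi> then of_nat (card Z) else 0)"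
    if \<chi>: "\<chi> \<in> chars" for \<chi>
  proof -
    let ?d = "\<lambda>z \<in> Z. \<psi> z / \<chi> z"
    have d: "?d \<in> chars" using Z_group.character_divide_closed[OF \<psi> \<chi>] by simp
    \<comment> \<open>Based at \<open>\<mu> q\<close>, where every lift is 1, the coset is
      parametrised by \<open>Z\<close>, and the quotient of lifts becomes
      \<open>\<psi> z / \<chi> z\<close>.\<close>
    have q_img: "q = (\<lambda>z. z \<otimes> \<mu> q) ` Z"
      using coset_\<mu>[OF q] by (auto simp: r_coset_def)
    have "inj_on (\<lambda>z. z \<otimes> \<mu> q) Z" using \<mu>_closed[OF q] by (auto simp: inj_on_def)
    then have "(\<Sum>g\<in>q. lift \<psi> g / lift \<chi> g) = (\<Sum>z\<in>Z. lift \<psi> (z \<otimes> \<mu> q) / lift \<chi> (z \<otimes> \<mu> q))"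
      by (subst q_img) (simp add: sum.reindex)
    also have "\<dots> = (\<Sum>z\<in>Z. ?d z)"
      using \<psi> \<chi> q by (intro sum.cong) (auto simp: lift_absorb lift_\<mu> \<mu>_closed)
    also have "\<dots> = (if ?d = (\<lambda>z \<in> Z. 1) then of_nat (card Z) else 0)"
      using Z_group.sum_character[OF _ d] finite_Z by simp
    also have "?d = (\<lambda>z \<in> Z. 1) \<longleftrightarrow> (\<forall>z\<in>Z. \<psi> z = \<chi> z)"
      using char_nonzero[OF \<chi>] by (auto simp: fun_eq_iff restrict_def)
    also have "\<dots> \<longleftrightarrow> \<chi> = \<psi>"
      using \<psi> \<chi> by (auto simp: Hom_units_def intro!: extensionalityI)
    finally show ?thesis .
  qed
  have "fourier (\<lambda>k \<in> carrier G. (\<Sum>\<chi>\<in>chars. H (\<chi>, Z #> k) / lift \<chi> k) / of_nat (card Z)) (\<psi>, q)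
    = (\<Sum>g\<in>q. (\<Sum>\<chi>\<in>chars. H (\<chi>, q) / lift \<chi> g) / of_nat (card Z) * lift \<psi> g)"
    using \<psi> q by (auto simp: fourier_def in_coset_iff intro!: sum.cong)
  also have "\<dots> = (\<Sum>g\<in>q. \<Sum>\<chi>\<in>chars. H (\<chi>, q) / of_nat (card Z) * (lift \<psi> g / lift \<chi> g))"
    unfolding sum_divide_distrib sum_distrib_right by (intro sum.cong) simp_all
  also have "\<dots> = (\<Sum>\<chi>\<in>chars. H (\<chi>, q) / of_nat (card Z) * (\<Sum>g\<in>q. lift \<psi> g / lift \<chi> g))"
    by (subst sum.swap) (simp only: sum_distrib_left)
  also have "\<dots> = (\<Sum>\<chi>\<in>chars. if \<chi> = \<psi> then H (\<psi>, q) else 0)"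
    using card_Z by (intro sum.cong) (auto simp: inner)
  also have "\<dots> = H (\<psi>, q)"
    using Z_group.finite_characters finite_Z \<psi> by simp
  finally show ?thesis .
qed

text \<open>Bijectivity comes from the two inversion formulas. For products,
  \<open>lift_mult\<close> contributes exactly the factor \<open>tra_cocycle \<chi>\<close>, while
  the inflated \<open>\<alpha>\<close> is constant on pairs of cosets, so the sums over
  \<open>G\<close> group into sums over the quotient.\<close>

lemma fourier_isomorphic:
  "complex_algebra_isomorphic
    (twisted_group_algebra G (pullback2 G (\<lambda>g. Z #> g) \<alpha>))
    (twisted_family chars Q (\<lambda>\<chi> p. \<alpha> p * tra_cocycle \<chi> p))"
    (is "complex_algebra_isomorphic ?A ?B")
proof (rule complex_algebra_isomorphicI[of fourier])
  \<comment> \<open>The trivial character shows that the factor in \<open>fourier_inversion\<close>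
    is nonzero and can be cancelled.\<close>
  have card: "card chars \<noteq> 0"
    using Z_group.finite_characters Z_group.trivial_character finite_Z by auto
  show "bij_betw fourier (carrier ?A) (carrier ?B)"
    unfolding bij_betw_def
  proof
    show "inj_on fourier (carrier ?A)"
    proof (rule inj_onI)
      fix f h assume f: "f \<in> carrier ?A" and h: "h \<in> carrier ?A" and eq: "fourier f = fourier h"
      have "f k = h k" if "k \<in> carrier G" for k
        using fourier_inversion[OF that, of f] fourier_inversion[OF that, of h] card by (simp add: eq)
      then show "f = h"
        using f h by (auto simp: twisted_group_algebra_def PiE_iff intro: extensionalityI)
    qed
    show "fourier ` carrier ?A = carrier ?B"
    proof
      show "fourier ` carrier ?A \<subseteq> carrier ?B"
        by (auto simp: twisted_family_def fourier_def split: if_splits)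
      show "carrier ?B \<subseteq> fourier ` carrier ?A"
      proof
        fix H assume H: "H \<in> carrier ?B"
        let ?f = "\<lambda>k \<in> carrier G. (\<Sum>\<chi>\<in>chars. H (\<chi>, Z #> k) / lift \<chi> k) / of_nat (card Z)"
        have "fourier ?f p = H p" for p
        proof (cases "p \<in> chars \<times> carrier Q")
          case True
          then show ?thesis by (cases p) (simp only: mem_Sigma_iff fourier_inverse)
        next
          case False
          then show ?thesis
            using H by (cases p) (auto simp: fourier_def twisted_family_def PiE_iff extensional_def)
        qed
        then have fH: "fourier ?f = H" by (rule ext)
        have "?f \<in> carrier ?A" by (simp add: twisted_group_algebra_def)
        from imageI[OF this, of fourier] show "H \<in> fourier ` carrier ?A" by (simp only: fH)
      qed
    qed
  qed
  show "fourier (f \<otimes>\<^bsub>?A\<^esub> h) = fourier f \<otimes>\<^bsub>?B\<^esub> fourier h" for f h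
  proof -
    have factor: "(\<Sum>g\<in>x. \<Sum>g'\<in>y. u g * v g' * c) = (\<Sum>g\<in>x. u g) * (\<Sum>g'\<in>y. v g') * c"
      for x y :: "'a set" and u v :: "'a \<Rightarrow> complex" and c
      by (subst sum_product) (simp only: sum_distrib_right)
    have "(\<Sum>k\<in>q. (f \<otimes>\<^bsub>?A\<^esub> h) k * lift \<chi> k) =
      (\<Sum>x\<in>carrier Q. \<Sum>y\<in>carrier Q. if x \<otimes>\<^bsub>Q\<^esub> y = q
        then fourier f (\<chi>, x) * fourier h (\<chi>, y) * (\<alpha> (x, y) * tra_cocycle \<chi> (x, y)) else 0)"
      if \<chi>: "\<chi> \<in> chars" and q: "q \<in> carrier Q" for \<chi> q
    proof -
      let ?\<alpha> = "\<lambda>g h. \<alpha> (Z #> g, Z #> h)"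
      have q_sub: "q \<subseteq> carrier G" using in_coset_iff[OF q] by blast
      then have fin_q: "finite q" using finite_G by (rule finite_subset)
      have "(\<Sum>k\<in>q. (f \<otimes>\<^bsub>?A\<^esub> h) k * lift \<chi> k) =
        (\<Sum>k\<in>q. \<Sum>g\<in>carrier G. \<Sum>g'\<in>carrier G.
          if g \<otimes> g' = k then f g * h g' * ?\<alpha> g g' * lift \<chi> (g \<otimes> g') else 0)"
        using q_sub
        by (auto simp: twisted_group_algebra_def pullback2_def sum_distrib_right intro!: sum.cong)
      also have "\<dots> = (\<Sum>g\<in>carrier G. \<Sum>g'\<in>carrier G. \<Sum>k\<in>q.
          if g \<otimes> g' = k then f g * h g' * ?\<alpha> g g' * lift \<chi> (g \<otimes> g') else 0)"
        by (subst sum.swap, rule sum.cong[OF refl], rule sum.swap)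
      \<comment> \<open>The sum over \<open>k\<close> keeps only \<open>k = g \<otimes> g'\<close>,
        which lies in \<open>q\<close> exactly when the product of the two cosets is
        \<open>q\<close>.\<close>
      also have "\<dots> = (\<Sum>g\<in>carrier G. \<Sum>g'\<in>carrier G. if (Z #> g) \<otimes>\<^bsub>Q\<^esub> (Z #> g') = q
          then (f g * lift \<chi> g) * (h g' * lift \<chi> g') *
            (?\<alpha> g g' * tra_cocycle \<chi> (Z #> g, Z #> g')) else 0)"
        using fin_q \<chi> by (intro sum.cong refl) (simp add: in_coset_iff[OF q] Q_mult lift_mult)
      also have "\<dots> = (\<Sum>x\<in>carrier Q. \<Sum>g\<in>x. \<Sum>y\<in>carrier Q. \<Sum>g'\<in>y. if x \<otimes>\<^bsub>Q\<^esub> y = q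
          then (f g * lift \<chi> g) * (h g' * lift \<chi> g') *
            (\<alpha> (x, y) * tra_cocycle \<chi> (x, y)) else 0)"
        by (simp only: sum_cosets)
      also have "\<dots> = (\<Sum>x\<in>carrier Q. \<Sum>y\<in>carrier Q. \<Sum>g\<in>x. \<Sum>g'\<in>y. if x \<otimes>\<^bsub>Q\<^esub> y = q
          then (f g * lift \<chi> g) * (h g' * lift \<chi> g') *
            (\<alpha> (x, y) * tra_cocycle \<chi> (x, y)) else 0)"
        by (rule sum.cong[OF refl], rule sum.swap)
      also have "\<dots> = (\<Sum>x\<in>carrier Q. \<Sum>y\<in>carrier Q. if x \<otimes>\<^bsub>Q\<^esub> y = q
        then fourier f (\<chi>, x) * fourier h (\<chi>, y) * (\<alpha> (x, y) * tra_cocycle \<chi> (x, y)) else 0)"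
        using \<chi> by (intro sum.cong refl) (simp add: fourier_def factor)
      finally show ?thesis .
    qed
    then show ?thesis
      by (auto simp: fourier_def[of "f \<otimes>\<^bsub>?A\<^esub> h"] twisted_family_def fun_eq_iff)
  qed
  show "fourier (f \<oplus>\<^bsub>?A\<^esub> h) = fourier f \<oplus>\<^bsub>?B\<^esub> fourier h" for f h
    by (auto simp: fourier_def twisted_family_def twisted_group_algebra_def fun_eq_iff
        in_coset_iff distrib_right simp flip: sum.distrib intro!: sum.cong)
  show "fourier (c \<odot>\<^bsub>?A\<^esub> f) = c \<odot>\<^bsub>?B\<^esub> fourier f" for c f
    by (auto simp: fourier_def twisted_family_def twisted_group_algebra_def fun_eq_iff
        in_coset_iff sum_distrib_left intro!: sum.cong)
  show "fourier \<one>\<^bsub>?A\<^esub> = \<one>\<^bsub>?B\<^esub>"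
  proof -
    have one: "Z #> \<one> = \<one>\<^bsub>Q\<^esub>" using hom_one[OF coset_hom is_group Q.is_group] .
    have "(\<Sum>g\<in>q. \<one>\<^bsub>?A\<^esub> g * lift \<chi> g) =
        (if q = \<one>\<^bsub>Q\<^esub> then inverse (\<alpha> (\<one>\<^bsub>Q\<^esub>, \<one>\<^bsub>Q\<^esub>) * tra_cocycle \<chi> (\<one>\<^bsub>Q\<^esub>, \<one>\<^bsub>Q\<^esub>)) else 0)"
      if \<chi>: "\<chi> \<in> chars" and q: "q \<in> carrier Q" for \<chi> q
    proof -
      have q_sub: "q \<subseteq> carrier G" using in_coset_iff[OF q] by blast
      then have fin_q: "finite q" using finite_G by (rule finite_subset)
      have "(\<Sum>g\<in>q. \<one>\<^bsub>?A\<^esub> g * lift \<chi> g) =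
          (\<Sum>g\<in>q. if g = \<one> then inverse (\<alpha> (\<one>\<^bsub>Q\<^esub>, \<one>\<^bsub>Q\<^esub>)) * lift \<chi> \<one> else 0)"
        using q_sub
        by (auto simp: twisted_group_algebra_def twisted_basis_def pullback2_def one intro!: sum.cong)
      also have "\<dots> = (if q = \<one>\<^bsub>Q\<^esub> then inverse (\<alpha> (\<one>\<^bsub>Q\<^esub>, \<one>\<^bsub>Q\<^esub>)) * lift \<chi> \<one> else 0)"
        using fin_q by (auto simp: in_coset_iff[OF q] one)
      \<comment> \<open>Both arguments are set to \<open>\<one>\<close> in
        \<open>tra_cocycle_lift\<close>. The value may differ from 1, since \<open>\<mu>\<close> may
        send the identity coset to any element of \<open>Z\<close>.\<close>
      also have "lift \<chi> \<one> = inverse (tra_cocycle \<chi> (\<one>\<^bsub>Q\<^esub>, \<one>\<^bsub>Q\<^esub>))"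
        using tra_cocycle_lift[OF \<chi> one_closed one_closed] lift_nonzero[OF \<chi> one_closed]
        by (simp add: one)
      finally show ?thesis by simp
    qed
    then show ?thesis by (auto simp: fourier_def twisted_family_def fun_eq_iff)
  qed
qed

end

section \<open>Comparison of the two central extensions\<close>

theorem corollary1p3:
  fixes G\<^sub>1 :: "('a, 'm) monoid_scheme" and G\<^sub>2 :: "('b, 'n) monoid_scheme"
    and Z\<^sub>1 :: "'a set" and Z\<^sub>2 :: "'b set"
    and \<mu>\<^sub>1 :: "'a set \<Rightarrow> 'a" and \<mu>\<^sub>2 :: "'b set \<Rightarrow> 'b"
    and i :: "'b \<Rightarrow> 'a" and \<phi> :: "'b set \<Rightarrow> 'a set"
  assumes "group G\<^sub>1" and "finite (carrier G\<^sub>1)"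
    and "group G\<^sub>2" and "finite (carrier G\<^sub>2)"
    and "central_subgroup Z\<^sub>1 G\<^sub>1" and "central_subgroup Z\<^sub>2 G\<^sub>2"
    and "is_section G\<^sub>1 Z\<^sub>1 \<mu>\<^sub>1" and "is_section G\<^sub>2 Z\<^sub>2 \<mu>\<^sub>2"
    and "short_exact (Hom_units (G\<^sub>1\<lparr>carrier := Z\<^sub>1\<rparr>)) (transgression G\<^sub>1 Z\<^sub>1 \<mu>\<^sub>1)
      (H2 (G\<^sub>1 Mod Z\<^sub>1)) (inflation G\<^sub>1 Z\<^sub>1) (H2 G\<^sub>1)"
    and "short_exact (Hom_units (G\<^sub>2\<lparr>carrier := Z\<^sub>2\<rparr>)) (transgression G\<^sub>2 Z\<^sub>2 \<mu>\<^sub>2)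
      (H2 (G\<^sub>2 Mod Z\<^sub>2)) (inflation G\<^sub>2 Z\<^sub>2) (H2 G\<^sub>2)"
    and "i \<in> iso (G\<^sub>2\<lparr>carrier := Z\<^sub>2\<rparr>) (G\<^sub>1\<lparr>carrier := Z\<^sub>1\<rparr>)"
    and "\<phi> \<in> iso (G\<^sub>2 Mod Z\<^sub>2) (G\<^sub>1 Mod Z\<^sub>1)"
    and "\<And>\<chi>. \<chi> \<in> carrier (Hom_units (G\<^sub>1\<lparr>carrier := Z\<^sub>1\<rparr>)) \<Longrightarrow>
      H2_map (G\<^sub>1 Mod Z\<^sub>1) (G\<^sub>2 Mod Z\<^sub>2) \<phi> (transgression G\<^sub>1 Z\<^sub>1 \<mu>\<^sub>1 \<chi>) =
      transgression G\<^sub>2 Z\<^sub>2 \<mu>\<^sub>2 (compose Z\<^sub>2 \<chi> i)"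
  shows "G\<^sub>1 \<sim>\<^sub>C G\<^sub>2"
proof -
  interpret E1: central_extension G\<^sub>1 Z\<^sub>1 \<mu>\<^sub>1
    using assms(1,2,5,7) by (simp add: central_extension_def central_extension_axioms_def)
  interpret E2: central_extension G\<^sub>2 Z\<^sub>2 \<mu>\<^sub>2
    using assms(3,4,6,8) by (simp add: central_extension_def central_extension_axioms_def)
  note tra_compat = assms(13)
  let ?inf1 = "inflation G\<^sub>1 Z\<^sub>1" and ?inf2 = "inflation G\<^sub>2 Z\<^sub>2"
  let ?tra1 = "transgression G\<^sub>1 Z\<^sub>1 \<mu>\<^sub>1" and ?tra2 = "transgression G\<^sub>2 Z\<^sub>2 \<mu>\<^sub>2"
  let ?\<Phi> = "H2_map E1.Q E2.Q \<phi>" and ?i = "\<lambda>\<chi>. compose Z\<^sub>2 \<chi> i"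
  have \<phi>: "\<phi> \<in> hom E2.Q E1.Q" using assms(12) by (simp add: iso_def)
  have i: "bij_betw ?i E1.chars E2.chars"
    using Hom_units_compose_bij[OF E2.Z_group.is_group E1.Z_group.is_group assms(11)] by simp
  \<comment> \<open>Exactness identifies each kernel of inflation with the image of transgression;
    compatibility carries one image onto the other because \<open>?i\<close> is onto
    \<open>E2.chars\<close>.\<close>
  have "?\<Phi> ` kernel (H2 E1.Q) (H2 G\<^sub>1) ?inf1 = ?\<Phi> ` ?tra1 ` E1.chars"
    using assms(9) by (simp add: short_exact_def)
  also have "\<dots> = ?tra2 ` ?i ` E1.chars"
    unfolding image_image by (rule image_cong[OF refl tra_compat])
  also have "?i ` E1.chars = E2.chars" using i by (simp add: bij_betw_def)
  also have "?tra2 ` E2.chars = kernel (H2 E2.Q) (H2 G\<^sub>2) ?inf2"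
    using assms(10) by (simp add: short_exact_def)
  finally have ker: "?\<Phi> ` kernel (H2 E1.Q) (H2 G\<^sub>1) ?inf1 = kernel (H2 E2.Q) (H2 G\<^sub>2) ?inf2" .
  have groups: "group (H2 E1.Q)" "group (H2 E2.Q)" "group (H2 G\<^sub>1)" "group (H2 G\<^sub>2)"
    by (simp_all add: H2_comm_group comm_group.axioms(2) E1.Q.is_group E2.Q.is_group
        E1.is_group E2.is_group)
  have inf_epi: "?inf1 \<in> epi (H2 E1.Q) (H2 G\<^sub>1)" "?inf2 \<in> epi (H2 E2.Q) (H2 G\<^sub>2)"
    using assms(9,10) by (simp_all add: short_exact_def)
  obtain \<psi> where \<psi>: "\<psi> \<in> iso (H2 G\<^sub>1) (H2 G\<^sub>2)"
    and \<psi>_inf: "\<And>c. c \<in> carrier (H2 E1.Q) \<Longrightarrow> \<psi> (?inf1 c) = ?inf2 (?\<Phi> c)"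
    using epi_induced_iso[OF groups inf_epi H2_map_iso[OF E2.Q.is_group E1.Q.is_group assms(12)] ker]
    by blast
  \<comment> \<open>The factor of a character \<open>\<chi>\<close> of \<open>Z\<^sub>2\<close> is
    matched with that of the character \<open>?a \<chi>\<close> of \<open>Z\<^sub>1\<close> whose
    composite with \<open>i\<close> is \<open>\<chi>\<close>.\<close>
  have family: "complex_algebra_isomorphic
      (twisted_family E1.chars E1.Q (\<lambda>\<chi> p. \<alpha> p * E1.tra_cocycle \<chi> p))
      (twisted_family E2.chars E2.Q (\<lambda>\<chi> p. pullback2 E2.Q \<phi> \<alpha> p * E2.tra_cocycle \<chi> p))" for \<alpha>
  proof -
    let ?a = "inv_into E1.chars ?i"
    have a: "bij_betw ?a E2.chars E1.chars" using i by (rule bij_betw_inv_into)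
    have "\<exists>l. (\<forall>x\<in>carrier E2.Q. l x \<noteq> 0) \<and>
        (\<forall>x\<in>carrier E2.Q. \<forall>y\<in>carrier E2.Q. E2.tra_cocycle \<chi> (x, y) =
          l x * l y / l (x \<otimes>\<^bsub>E2.Q\<^esub> y) * pullback2 E2.Q \<phi> (E1.tra_cocycle (?a \<chi>)) (x, y))"
      if \<chi>: "\<chi> \<in> E2.chars" for \<chi>
    proof (rule cohom_classD)
      have a\<chi>: "?a \<chi> \<in> E1.chars" "?i (?a \<chi>) = \<chi>"
        using bij_betwE[OF a] bij_betw_inv_into_right[OF i \<chi>] \<chi> by auto
      \<comment> \<open>Compatibility is an equality of classes only, so the cocycles agree up to a
        coboundary that depends on \<open>\<chi>\<close>.\<close>
      have "cohom_class E2.Q (pullback2 E2.Q \<phi> (E1.tra_cocycle (?a \<chi>))) =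
          cohom_class E2.Q (E2.tra_cocycle \<chi>)"
        using tra_compat[OF a\<chi>(1)] a\<chi>
        by (simp add: E1.transgression_eq E2.transgression_eq E1.tra_cocycle_closed
            H2_map_class[OF E2.Q.is_group E1.Q.is_group \<phi>])
      then show "E2.tra_cocycle \<chi> \<in> cohom_class E2.Q (pullback2 E2.Q \<phi> (E1.tra_cocycle (?a \<chi>)))"
        using cohom_class_self[OF E2.Q.is_group E2.tra_cocycle_closed[OF \<chi>]] by simp
    qed
    then have "\<exists>l. \<forall>\<chi>\<in>E2.chars. (\<forall>x\<in>carrier E2.Q. l \<chi> x \<noteq> 0) \<and>
        (\<forall>x\<in>carrier E2.Q. \<forall>y\<in>carrier E2.Q. E2.tra_cocycle \<chi> (x, y) =
          l \<chi> x * l \<chi> y / l \<chi> (x \<otimes>\<^bsub>E2.Q\<^esub> y) *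
          pullback2 E2.Q \<phi> (E1.tra_cocycle (?a \<chi>)) (x, y))"
      by (intro bchoice ballI)
    then obtain l where "\<forall>\<chi>\<in>E2.chars. (\<forall>x\<in>carrier E2.Q. l \<chi> x \<noteq> 0) \<and>
        (\<forall>x\<in>carrier E2.Q. \<forall>y\<in>carrier E2.Q. E2.tra_cocycle \<chi> (x, y) =
          l \<chi> x * l \<chi> y / l \<chi> (x \<otimes>\<^bsub>E2.Q\<^esub> y) *
          pullback2 E2.Q \<phi> (E1.tra_cocycle (?a \<chi>)) (x, y))" ..
    \<comment> \<open>The factor coming from \<open>\<alpha>\<close> is transported exactly by the
      pullback, so the rescaling found for the transgression cocycles also serves for the
      products.\<close>
    then show ?thesis
      by (intro twisted_family_isomorphic[OF E1.Q.is_group E2.Q.is_group assms(12) a, of l])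
        (simp_all add: pullback2_def)
  qed
  have "complex_algebra_isomorphic (twisted_group_algebra G\<^sub>1 \<alpha>) (twisted_group_algebra G\<^sub>2 \<beta>)"
    if \<alpha>: "\<alpha> \<in> carrier (cocycles2 G\<^sub>1)" and \<beta>: "\<beta> \<in> \<psi> (cohom_class G\<^sub>1 \<alpha>)" for \<alpha> \<beta>
  proof -
    \<comment> \<open>Surjectivity of inflation reduces the claim to twists inflated from the
      quotient, to which the Fourier decomposition applies.\<close>
    have "cohom_class G\<^sub>1 \<alpha> \<in> ?inf1 ` carrier (H2 E1.Q)"
      using assms(9) \<alpha> by (simp add: short_exact_def epi_def carrier_H2)
    then obtain \<gamma> where \<gamma>: "\<gamma> \<in> carrier (cocycles2 E1.Q)"
      and inf: "cohom_class G\<^sub>1 \<alpha> = ?inf1 (cohom_class E1.Q \<gamma>)"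
      by (auto simp: carrier_H2)
    let ?\<gamma>1 = "pullback2 G\<^sub>1 (\<lambda>g. Z\<^sub>1 #>\<^bsub>G\<^sub>1\<^esub> g) \<gamma>"
    let ?\<delta> = "pullback2 E2.Q \<phi> \<gamma>"
    let ?\<delta>2 = "pullback2 G\<^sub>2 (\<lambda>g. Z\<^sub>2 #>\<^bsub>G\<^sub>2\<^esub> g) ?\<delta>"
    have \<delta>: "?\<delta> \<in> carrier (cocycles2 E2.Q)"
      using pullback2_closed[OF E2.Q.is_group \<phi> \<gamma>] .
    have "cohom_class G\<^sub>1 \<alpha> = cohom_class G\<^sub>1 ?\<gamma>1"
      using inf \<gamma> by (simp add: inflation_def H2_map_class[OF E1.is_group E1.Q.is_group E1.coset_hom])
    then have "?\<gamma>1 \<in> cohom_class G\<^sub>1 \<alpha>"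
      using cohom_class_self[OF E1.is_group pullback2_closed[OF E1.is_group E1.coset_hom \<gamma>]] by simp
    then have iso1: "complex_algebra_isomorphic
        (twisted_group_algebra G\<^sub>1 \<alpha>) (twisted_group_algebra G\<^sub>1 ?\<gamma>1)"
      by (rule twisted_group_algebra_cohomologous[OF E1.is_group])
    \<comment> \<open>The relation \<open>\<psi>_inf\<close> shows that the class of
      \<open>\<beta>\<close> is the inflation of the pullback of \<open>\<gamma>\<close> along
      \<open>\<phi>\<close>.\<close>
    have "\<psi> (cohom_class G\<^sub>1 \<alpha>) = cohom_class G\<^sub>2 ?\<delta>2"
      using \<gamma> \<delta> \<psi>_inf[of "cohom_class E1.Q \<gamma>"]
      by (simp add: inf inflation_def carrier_H2 H2_map_class[OF E2.is_group E2.Q.is_group E2.coset_hom]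
          H2_map_class[OF E2.Q.is_group E1.Q.is_group \<phi>])
    then have iso2: "complex_algebra_isomorphic
        (twisted_group_algebra G\<^sub>2 ?\<delta>2) (twisted_group_algebra G\<^sub>2 \<beta>)"
      using \<beta> by (intro twisted_group_algebra_cohomologous[OF E2.is_group]) simp
    \<comment> \<open>The chain decomposes the algebra of \<open>G\<^sub>1\<close>, matches the
      factors, and reassembles them into the algebra of \<open>G\<^sub>2\<close>.\<close>
    note complex_algebra_isomorphic_trans[OF iso1 E1.fourier_isomorphic]
    note complex_algebra_isomorphic_trans[OF this family]
    note complex_algebra_isomorphic_trans[OF this
        twisted_group_algebra_isomorphic_sym[OF E2.fourier_isomorphic]]
    from complex_algebra_isomorphic_trans[OF this iso2] show ?thesis .
  qed
  then show ?thesis unfolding tga_equiv_def using \<psi> by blast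
qed

end
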